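(* Every semifield of order $2^4$ has tensor rank exactly $9$ over $\mathbb{F}_2$.
   Context: A finite semifield over $\mathbb{F}_q$ is a vector space $V=\mathbb{F}_q^n$ with an $\mathbb{F}_q$-bilinear multiplication $\circ$ (not necessarily associative) possessing an identity element, such that $x\circ y=0$ if and only if $x=0$ or $y=0$. Semifields of order $2^4$ are regarded as $4$-dimensional algebras over $\mathbb{F}_2$, even when their centre is larger. The multiplication $\circ$ corresponds to a tensor in $\mathrm{Hom}(V\otimes V,V)\cong V^\vee\otimes V^\vee\otimes V$. The tensor rank over $\mathbb{F}_q$ of $(V,\circ)$ is the least $R$ such that this tensor is a sum of $R$ pure tensors, i.e. such that $x\circ y=\sum_{i=1}^Ra_i^\vee(x)b_i^\vee(y)z_i$ for all $x,y\in V$, for some $a_i^\vee,b_i^\vee\in V^\vee$ and $z_i\in V$. *)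

theory Defs
  imports "HOL-Analysis.Analysis" "HOL-Library.Z2"
begin

text \<open>The library type \<^typ>\<open>bit\<close> is the field with two elements.\<close>

instance bit :: finite
proof
  have "(UNIV :: bit set) \<subseteq> {0, 1}"
    by (metis (full_types) bit_not_zero_iff insertCI subsetI)
  then show "finite (UNIV :: bit set)"
    by (rule finite_subset) simp
qed

definition bilinear_mult :: "('a::field ^ 'n \<Rightarrow> 'a ^ 'n \<Rightarrow> 'a ^ 'n) \<Rightarrow> bool" where
  "bilinear_mult m \<longleftrightarrow>
     (\<forall>x. Vector_Spaces.linear (*s) (*s) (\<lambda>y. m x y)) \<and>
     (\<forall>y. Vector_Spaces.linear (*s) (*s) (\<lambda>x. m x y))"

definition finite_semifield ::
    "('a::{field,finite} ^ 'n::finite \<Rightarrow> 'a ^ 'n \<Rightarrow> 'a ^ 'n) \<Rightarrow> bool" where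
  "finite_semifield m \<longleftrightarrow>
     bilinear_mult m \<and>
     (\<exists>e. \<forall>x. m e x = x \<and> m x e = x) \<and>
     (\<forall>x y. m x y = 0 \<longleftrightarrow> x = 0 \<or> y = 0)"

definition linear_form :: "('a::field ^ 'n \<Rightarrow> 'a) \<Rightarrow> bool" where
  "linear_form f \<longleftrightarrow> Vector_Spaces.linear (*s) (*) f"

definition sum_of_pure_tensors ::
    "('a::field ^ 'n \<Rightarrow> 'a ^ 'n \<Rightarrow> 'a ^ 'n) \<Rightarrow> nat \<Rightarrow> bool" where
  "sum_of_pure_tensors m R \<longleftrightarrow>
     (\<exists>(a :: nat \<Rightarrow> 'a ^ 'n \<Rightarrow> 'a) (b :: nat \<Rightarrow> 'a ^ 'n \<Rightarrow> 'a) (z :: nat \<Rightarrow> 'a ^ 'n).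
        (\<forall>i<R. linear_form (a i) \<and> linear_form (b i)) \<and>
        (\<forall>x y. m x y = (\<Sum>i<R. (a i x * b i y) *s z i)))"

text \<open>Only meaningful for bilinear \<open>m\<close>; for these some decomposition always exists.\<close>

definition tensor_rank :: "('a::field ^ 'n \<Rightarrow> 'a ^ 'n \<Rightarrow> 'a ^ 'n) \<Rightarrow> nat" where
  "tensor_rank m = (LEAST R. sum_of_pure_tensors m R)"

end

theory Submission
  imports Defs
begin

text \<open>
  Lower bound: let \<open>x y = \<Sum>i<8. a\<^sub>i(x) b\<^sub>i(y) z\<^sub>i\<close>. Since there are no zero divisors, each of the
  families \<open>a\<close>, \<open>b\<close>, \<open>z\<close> generates a binary code of length 8, dimension 4 and minimum distance at
  least 4. Such a code has only even weights and contains the all-one word. If \<open>x\<close> and \<open>y\<close> give the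
  all-one words of the codes of \<open>a\<close> and \<open>b\<close>, then \<open>x y = \<Sum>i. z\<^sub>i\<close>, which is 0 as the code of \<open>z\<close>
  has even weights: a contradiction.

  Upper bound: some \<open>x\<close> has \<open>e\<close>, \<open>x\<close>, \<open>x x\<close>, \<open>x (x x)\<close> as a basis, where \<open>e\<close> is the identity. In this
  basis only 178 multiplication tables without zero divisors are possible, and each of them
  is a sum of nine explicit pure tensors.
\<close>

text \<open>Sums and products in \<open>bit\<close> are to keep their ring form, to which additivity
  and the ring lemmas apply; these rules would turn them into \<open>XOR\<close> and
  \<open>AND\<close>.\<close>

declare add_bit_eq_xor [simp del] mult_bit_eq_and [simp del]

section \<open>Groups of exponent two\<close>

text \<open>Such groups are the vector spaces over the field with two elements. As the only scalars
  are 0 and 1, linearity of a map amounts to additivity.\<close>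

class char_two_group = ab_group_add +
  assumes add_self [simp]: "x + x = 0"
begin

lemma add_self_left [simp]: "x + (x + y) = y"
  by (simp flip: add.assoc)

lemma add_eq_0_iff_eq: "x + y = 0 \<longleftrightarrow> x = y"
  by (metis add_self add_self_left add_0_right)

end

instance bit :: char_two_group
proof
  show "x + x = 0" for x :: bit by (cases x) simp_all
qed

instance vec :: (char_two_group, finite) char_two_group
  by standard (simp add: vec_eq_iff)

section \<open>Spans over the field with two elements\<close>

primrec shift :: "'a::plus \<Rightarrow> 'a list \<Rightarrow> 'a list" where
  "shift c [] = []"
| "shift c (x # xs) = (c + x) # shift c xs"

text \<open>In a group of exponent two this is the span of the list, with repetitions if the list is
  dependent.\<close>

primrec subset_sums :: "'a::monoid_add list \<Rightarrow> 'a list" where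
  "subset_sums [] = [0]"
| "subset_sums (c # cs) = subset_sums cs @ shift c (subset_sums cs)"

text \<open>In a group of exponent two this is linear independence: each entry avoids the span of
  the later ones.\<close>

primrec independent_list :: "'a::monoid_add list \<Rightarrow> bool" where
  "independent_list [] \<longleftrightarrow> True"
| "independent_list (c # cs) \<longleftrightarrow> independent_list cs \<and> c \<notin> set (subset_sums cs)"

lemma shift_eq_map: "shift c xs = map ((+) c) xs"
  by (induction xs) auto

lemma length_subset_sums [simp]: "length (subset_sums cs) = 2 ^ length cs"
  by (induction cs) (auto simp: shift_eq_map)

lemma zero_in_subset_sums [simp]: "0 \<in> set (subset_sums cs)"
  by (induction cs) auto

lemma in_subset_sums: "c \<in> set cs \<Longrightarrow> c \<in> set (subset_sums cs)"
proof (induction cs)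
  case (Cons d cs)
  have "d \<in> (+) d ` set (subset_sums cs)"
    by (rule image_eqI[of _ _ 0]) simp_all
  with Cons show ?case by (auto simp: shift_eq_map)
qed simp

text \<open>Both summands are an element of the span of the tail, possibly plus \<open>c\<close>;
  two copies of \<open>c\<close> cancel.\<close>

lemma add_in_subset_sums:
  fixes cs :: "'a::char_two_group list"
  assumes "u \<in> set (subset_sums cs)" "v \<in> set (subset_sums cs)"
  shows "u + v \<in> set (subset_sums cs)"
  using assms
proof (induction cs arbitrary: u v)
  case (Cons c cs)
  have split: "\<exists>w\<in>set (subset_sums cs). t = w \<or> t = c + w" if "t \<in> set (subset_sums (c # cs))" for t
    using that by (auto simp: shift_eq_map)
  obtain u' where u': "u' \<in> set (subset_sums cs)" "u = u' \<or> u = c + u'"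
    using split[OF Cons.prems(1)] by blast
  obtain v' where v': "v' \<in> set (subset_sums cs)" "v = v' \<or> v = c + v'"
    using split[OF Cons.prems(2)] by blast
  have "u' + v' \<in> set (subset_sums cs)"
    using Cons.IH u' v' by blast
  moreover have "u + v = u' + v' \<or> u + v = c + (u' + v')"
  proof -
    have "(c + u') + (c + v') = u' + v'"
      by (metis add.left_commute add_self_left add.assoc)
    with u'(2) v'(2) show ?thesis
      by (auto simp: ac_simps)
  qed
  ultimately show ?case
    by (auto simp: shift_eq_map)
qed simp

lemma subset_sums_subset:
  fixes cs :: "'a::char_two_group list"
  shows "set ds \<subseteq> set (subset_sums cs) \<Longrightarrow> set (subset_sums ds) \<subseteq> set (subset_sums cs)"
  by (induction ds) (auto simp: shift_eq_map add_in_subset_sums subset_iff)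

text \<open>A coincidence \<open>c + u = v\<close> between the two halves would give
  \<open>c = u + v\<close>, an element of the span of the tail.\<close>

lemma distinct_subset_sums:
  fixes cs :: "'a::char_two_group list"
  shows "independent_list cs \<Longrightarrow> distinct (subset_sums cs)"
proof (induction cs)
  case (Cons c cs)
  have "c + u \<noteq> v" if "u \<in> set (subset_sums cs)" "v \<in> set (subset_sums cs)" for u v
  proof
    assume "c + u = v"
    then have "c = u + v"
      by (metis add.commute add_self_left)
    then show False
      using add_in_subset_sums[OF that] Cons.prems by simp
  qed
  then show ?case
    using Cons by (fastforce simp: shift_eq_map distinct_map)
qed simp

lemma card_subset_sums:
  fixes cs :: "'a::char_two_group list"
  shows "independent_list cs \<Longrightarrow> card (set (subset_sums cs)) = 2 ^ length cs"
  by (simp add: distinct_card distinct_subset_sums)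

lemma subset_sums_eq_UNIV:
  fixes cs :: "'a::{char_two_group, finite} list"
  assumes "independent_list cs" "CARD('a) = 2 ^ length cs"
  shows "set (subset_sums cs) = UNIV"
  using assms by (intro card_seteq) (auto simp: card_subset_sums)

lemma subset_sums_map:
  assumes "\<And>x y. f (x + y) = f x + f y" "f 0 = 0"
  shows "subset_sums (map f cs) = map f (subset_sums cs)"
  using assms by (induction cs) (auto simp: shift_eq_map)

section \<open>Biadditive maps\<close>

locale biadditive =
  fixes m :: "'a::char_two_group \<Rightarrow> 'b::char_two_group \<Rightarrow> 'c::char_two_group"
  assumes add_left: "m (x + x') y = m x y + m x' y"
    and add_right: "m x (y + y') = m x y + m x y'"
begin

lemma zero_left [simp]: "m 0 y = 0"
  using add_left[of 0 0 y] by simp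

lemma zero_right [simp]: "m x 0 = 0"
  using add_right[of x 0 0] by simp

lemma subset_sums_map_right: "subset_sums (map (m x) ys) = map (m x) (subset_sums ys)"
  by (rule subset_sums_map) (simp_all add: add_right)

end

lemma biadditive_eqI:
  assumes "biadditive m" "biadditive n"
    and "\<And>u v. u \<in> set us \<Longrightarrow> v \<in> set vs \<Longrightarrow> m u v = n u v"
    and "x \<in> set (subset_sums us)" "y \<in> set (subset_sums vs)"
  shows "m x y = n x y"
proof -
  interpret m: biadditive m by fact
  interpret n: biadditive n by fact
  have "m u y = n u y" if "u \<in> set us" for u
    using assms(5) assms(3)[OF that]
    by (induction vs arbitrary: y) (auto simp: shift_eq_map m.add_right n.add_right)
  then show ?thesis
    using assms(4)
    by (induction us arbitrary: x) (auto simp: shift_eq_map m.add_left n.add_left)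
qed

locale nonsingular = biadditive +
  assumes no_zero_divisors: "m x y = 0 \<Longrightarrow> x = 0 \<or> y = 0"

section \<open>Enumeration of nonsingular multiplication tables\<close>

text \<open>
  A multiplication is tabulated as a list of rows with respect to lists of left and right
  arguments. Tables grow at the head: the row of \<open>x\<close> may be extended by a value \<open>c\<close> in the
  column of \<open>y\<close> iff for each sum \<open>x'\<close> of labels of complete rows the value \<open>c + x' y\<close>
  avoids the span of the products of \<open>x + x'\<close> with the column labels already treated. All functions
  are first order, as the simplifier renormalises evaluated data under abstractions.
\<close>

fun add_rows :: "'a::plus list \<Rightarrow> 'a list \<Rightarrow> 'a list" where
  "add_rows (x # xs) (y # ys) = (x + y) # add_rows xs ys"
| "add_rows xs ys = []"

primrec shift_rows :: "'a::plus list \<Rightarrow> 'a list list \<Rightarrow> 'a list list" where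
  "shift_rows r [] = []"
| "shift_rows r (x # xs) = add_rows r x # shift_rows r xs"

text \<open>The analogue of \<open>subset_sums\<close> for rows: by biadditivity it lists the rows
  of all sums of left labels. The width \<open>n\<close> serves for the zero row, whose length an
  empty table does not determine.\<close>

primrec row_sums :: "nat \<Rightarrow> 'a::monoid_add list list \<Rightarrow> 'a list list" where
  "row_sums n [] = [replicate n 0]"
| "row_sums n (r # rs) = row_sums n rs @ shift_rows r (row_sums n rs)"

primrec tails :: "'a list list \<Rightarrow> 'a list list" where
  "tails [] = []"
| "tails (x # xs) = tl x # tails xs"

primrec mem :: "'a \<Rightarrow> 'a list \<Rightarrow> bool" where
  "mem x [] \<longleftrightarrow> False"
| "mem x (y # ys) \<longleftrightarrow> (if x = y then True else mem x ys)"

primrec minus_list :: "'a list \<Rightarrow> 'a list \<Rightarrow> 'a list" where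
  "minus_list F [] = []"
| "minus_list F (x # xs) = (if mem x F then minus_list F xs else x # minus_list F xs)"

text \<open>\<open>r\<close> is the known part of the row of \<open>x\<close>, \<open>C\<close>
  holds the candidates for the new column, and each \<open>M\<close> is the row of some
  \<open>x'\<close> with the new column at its head. So \<open>add_rows (tl M) r\<close> is the
  known part of the row of \<open>x' + x\<close>.\<close>

primrec admissible :: "'a::monoid_add list \<Rightarrow> 'a list \<Rightarrow> 'a list list \<Rightarrow> 'a list" where
  "admissible r C [] = C"
| "admissible r C (M # Ms) =
     admissible r (minus_list (shift (hd M) (subset_sums (add_rows (tl M) r))) C) Ms"

primrec attach :: "'a list \<Rightarrow> 'a list \<Rightarrow> 'a list list" where
  "attach rs [] = []"
| "attach rs (x # xs) = (x # rs) # attach rs xs"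

primrec attach_columns :: "'a::monoid_add list \<Rightarrow> 'a list list \<Rightarrow> 'a list list \<Rightarrow> 'a list list" where
  "attach_columns C Ms [] = []"
| "attach_columns C Ms (r # rs) = attach r (admissible r C Ms) @ attach_columns C Ms rs"

primrec row_extensions :: "'a::monoid_add list list \<Rightarrow> 'a list list \<Rightarrow> 'a list list" where
  "row_extensions [] Ms = [[]]"
| "row_extensions (C # Cs) Ms = attach_columns C Ms (row_extensions Cs (tails Ms))"

primrec attach_rows ::
    "nat \<Rightarrow> 'a::monoid_add list list \<Rightarrow> 'a list list list \<Rightarrow> 'a list list list" where
  "attach_rows n C [] = []"
| "attach_rows n C (rs # xs) = attach rs (row_extensions C (row_sums n rs)) @ attach_rows n C xs"

primrec table_extensions :: "nat \<Rightarrow> 'a::monoid_add list list list \<Rightarrow> 'a list list list" where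
  "table_extensions n [] = [[]]"
| "table_extensions n (C # Cs) = attach_rows n C (table_extensions n Cs)"

section \<open>Completeness of the enumeration\<close>

lemma add_rows_map: "add_rows (map f xs) (map g xs) = map (\<lambda>x. f x + g x) xs"
  by (induction xs) auto

lemma shift_rows_eq_map: "shift_rows r xs = map (add_rows r) xs"
  by (induction xs) auto

lemma tails_eq_map: "tails xs = map tl xs"
  by (induction xs) auto

lemma mem_iff: "mem x xs \<longleftrightarrow> x \<in> set xs"
  by (induction xs) auto

lemma set_minus_list: "set (minus_list F xs) = set xs - set F"
  by (induction xs) (auto simp: mem_iff)

lemma set_attach: "set (attach rs xs) = (\<lambda>x. x # rs) ` set xs"
  by (induction xs) auto

lemma set_attach_columns:
  "set (attach_columns C Ms rs) = (\<Union>r\<in>set rs. (\<lambda>c. c # r) ` set (admissible r C Ms))"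
  by (induction rs) (auto simp: set_attach)

lemma set_attach_rows:
  "set (attach_rows n C xs) = (\<Union>rs\<in>set xs. (\<lambda>r. r # rs) ` set (row_extensions C (row_sums n rs)))"
  by (induction xs) (auto simp: set_attach)

text \<open>If the value were struck out because of \<open>x'\<close>, then
  \<open>m (x' + x) (y + v) = 0\<close> for some \<open>v\<close> in the span of \<open>ys\<close>.
  Since \<open>x' + x\<close> is nonzero, \<open>y = v\<close>, but \<open>y\<close> is outside that
  span.\<close>

lemma (in nonsingular) in_admissible:
  assumes "\<forall>x'\<in>set xs'. x' + x \<noteq> 0" "y \<notin> set (subset_sums ys)" "m x y \<in> set C"
  shows "m x y \<in> set (admissible (map (m x) ys) C (map (\<lambda>x'. map (m x') (y # ys)) xs'))"
  using assms
proof (induction xs' arbitrary: C)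
  case (Cons x' xs')
  have "m x y \<noteq> m x' y + m (x' + x) v" if "v \<in> set (subset_sums ys)" for v
  proof
    assume "m x y = m x' y + m (x' + x) v"
    then have "m (x' + x) (y + v) = 0"
      by (simp add: add_left add_right add_eq_0_iff_eq)
    moreover have "x' + x \<noteq> 0"
      using Cons.prems(1) by simp
    ultimately have "y + v = 0"
      using no_zero_divisors by blast
    then have "y = v"
      by (simp add: add_eq_0_iff_eq)
    with that Cons.prems(2) show False by simp
  qed
  then have "m x y \<notin> set (shift (m x' y) (subset_sums (add_rows (map (m x') ys) (map (m x) ys))))"
    by (auto simp: shift_eq_map add_rows_map subset_sums_map_right simp flip: add_left)
  with Cons show ?case
    by (simp add: set_minus_list)
qed simp

lemma (in nonsingular) row_in_row_extensions:
  assumes "\<forall>x'\<in>set xs'. x' + x \<noteq> 0" "independent_list ys"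
    and "list_all2 (\<lambda>y C. m x y \<in> set C) ys Cs"
  shows "map (m x) ys \<in> set (row_extensions Cs (map (\<lambda>x'. map (m x') ys) xs'))"
  using assms(3,2)
proof (induction rule: list_all2_induct)
  case (Cons y ys C Cs)
  then have "map (m x) ys \<in> set (row_extensions Cs (map (\<lambda>x'. map (m x') ys) xs'))"
    by simp
  moreover have "m x y \<in> set (admissible (map (m x) ys) C (map (\<lambda>x'. map (m x') (y # ys)) xs'))"
    using in_admissible assms(1) Cons by simp
  ultimately show ?case
    by (auto simp: set_attach_columns tails_eq_map comp_def)
qed simp

lemma (in biadditive) row_sums_table:
  "row_sums (length ys) (map (\<lambda>x. map (m x) ys) xs) = map (\<lambda>x. map (m x) ys) (subset_sums xs)"
proof (induction xs)
  case Nil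
  show ?case by (induction ys) auto
qed (auto simp: shift_rows_eq_map shift_eq_map add_rows_map add_left)

text \<open>The search loses no table: independence of the left labels makes every
  \<open>x' + x\<close> nonzero, so each row survives by the previous lemmas.\<close>

lemma (in nonsingular) table_in_table_extensions:
  assumes "independent_list xs" "independent_list ys"
    and "list_all2 (\<lambda>x. list_all2 (\<lambda>y C. m x y \<in> set C) ys) xs Cs"
  shows "map (\<lambda>x. map (m x) ys) xs \<in> set (table_extensions (length ys) Cs)"
  using assms(3,1)
proof (induction rule: list_all2_induct)
  case (Cons x xs C Cs)
  then have "\<forall>x'\<in>set (subset_sums xs). x' + x \<noteq> 0"
    by (auto simp: add_eq_0_iff_eq)
  then have "map (m x) ys \<in> set (row_extensions C (row_sums (length ys) (map (\<lambda>x. map (m x) ys) xs)))"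
    unfolding row_sums_table using row_in_row_extensions assms(2) Cons by blast
  with Cons show ?case
    by (auto simp: set_attach_rows)
qed simp

section \<open>The normalised tables of order sixteen\<close>

text \<open>A first-order copy of \<open>bit ^ 4\<close> on which computation by rewriting is
  practicable. The components will be the coordinates with respect to \<open>e\<close>,
  \<open>x\<close>, \<open>x x\<close>, \<open>x (x x)\<close>.\<close>

datatype quad = Quad bit bit bit bit

instantiation quad :: char_two_group
begin

definition "0 = Quad 0 0 0 0"

fun plus_quad where
  "Quad a b c d + Quad a' b' c' d' = Quad (a + a') (b + b') (c + c') (d + d')"

definition "- (x :: quad) = x"

definition "(x :: quad) - y = x + y"

instance
proof
  show "x - y = x + - y" for x y :: quad by (simp add: minus_quad_def uminus_quad_def)
  show "- x + x = 0" for x :: quad by (cases x) (simp add: uminus_quad_def zero_quad_def)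
  show "0 + x = x" for x :: quad by (cases x) (simp add: zero_quad_def)
  show "x + y = y + x" for x y :: quad by (cases x; cases y) (simp add: add.commute)
  show "x + y + z = x + (y + z)" for x y z :: quad
    by (cases x; cases y; cases z) (simp add: add.assoc)
  show "x + x = 0" for x :: quad by (cases x) (simp add: zero_quad_def)
qed

end

text \<open>Through this form a \<open>quad\<close> also encodes a linear form.\<close>

fun dot :: "quad \<Rightarrow> quad \<Rightarrow> bit" where
  "dot (Quad a b c d) (Quad a' b' c' d') = a * a' + (b * b' + (c * c' + d * d'))"

text \<open>The standard basis in reverse: tables grow at the head, so the row and the column of the
  identity come first in the search.\<close>

definition unit_quads :: "quad list" where
  "unit_quads = [Quad 0 0 0 1, Quad 0 0 1 0, Quad 0 1 0 0, Quad 1 0 0 0]"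

text \<open>The columns prescribe an identity \<open>e\<close> and the products \<open>x e = x\<close>, \<open>x x\<close>, \<open>x (x x)\<close> as
  basis vectors.\<close>

definition normalised_columns :: "quad list list list" where
  "normalised_columns =
     (let A = subset_sums unit_quads; s = map (\<lambda>v. [v]) unit_quads in
      [[A, A, A, s ! 0], [A, A, A, s ! 1], [A, s ! 0, s ! 1, s ! 2], s])"

text \<open>A triple \<open>(a, b, z)\<close> stands for the pure tensor with forms
  \<open>dot a\<close>, \<open>dot b\<close> and vector \<open>z\<close>; the conditional is the
  scalar multiple of \<open>z\<close>.\<close>

primrec tensor_mult :: "(quad \<times> quad \<times> quad) list \<Rightarrow> quad \<Rightarrow> quad \<Rightarrow> quad" where
  "tensor_mult [] x y = 0"
| "tensor_mult (t # ts) x y = (case t of (a, b, z) \<Rightarrow>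
     (if dot a x * dot b y = 1 then z else 0) + tensor_mult ts x y)"

primrec tensor_row :: "(quad \<times> quad \<times> quad) list \<Rightarrow> quad \<Rightarrow> quad list \<Rightarrow> quad list" where
  "tensor_row ts x [] = []"
| "tensor_row ts x (y # ys) = tensor_mult ts x y # tensor_row ts x ys"

primrec tensor_table :: "(quad \<times> quad \<times> quad) list \<Rightarrow> quad list \<Rightarrow> quad list \<Rightarrow> quad list list" where
  "tensor_table ts [] ys = []"
| "tensor_table ts (x # xs) ys = tensor_row ts x ys # tensor_table ts xs ys"

primrec tensor_tables :: "(quad \<times> quad \<times> quad) list list \<Rightarrow> quad list list list" where
  "tensor_tables [] = []"
| "tensor_tables (ts # tss) = tensor_table ts unit_quads unit_quads # tensor_tables tss"

text \<open>The suffix is a hexadecimal digit whose binary digits, lowest first, are the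
  components.\<close>

abbreviation (input) "q0 \<equiv> Quad 0 0 0 0"
abbreviation (input) "q1 \<equiv> Quad 1 0 0 0"
abbreviation (input) "q2 \<equiv> Quad 0 1 0 0"
abbreviation (input) "q3 \<equiv> Quad 1 1 0 0"
abbreviation (input) "q4 \<equiv> Quad 0 0 1 0"
abbreviation (input) "q5 \<equiv> Quad 1 0 1 0"
abbreviation (input) "q6 \<equiv> Quad 0 1 1 0"
abbreviation (input) "q7 \<equiv> Quad 1 1 1 0"
abbreviation (input) "q8 \<equiv> Quad 0 0 0 1"
abbreviation (input) "q9 \<equiv> Quad 1 0 0 1"
abbreviation (input) "qA \<equiv> Quad 0 1 0 1"
abbreviation (input) "qB \<equiv> Quad 1 1 0 1"
abbreviation (input) "qC \<equiv> Quad 0 0 1 1"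
abbreviation (input) "qD \<equiv> Quad 1 0 1 1"
abbreviation (input) "qE \<equiv> Quad 0 1 1 1"
abbreviation (input) "qF \<equiv> Quad 1 1 1 1"

text \<open>Found by a random search for nonsingular tensors among those made of three codes of length 9,
  dimension 4 and distance 4. All 178 tables arise from a few such tensors by isotopisms. They are
  listed in the order of \<^const>\<open>table_extensions\<close>.\<close>

definition decompositions :: "(quad \<times> quad \<times> quad) list list" where
  "decompositions = [
   [(q1,qE,qE), (q2,q8,q5), (q6,q7,q4), (q8,q3,q9), (q9,q1,q7),
    (qB,qD,q6), (qC,qC,q1), (qD,q6,qC), (qE,q4,qA)],
   [(q1,q4,q4), (q3,q3,q9), (q4,q1,q1), (q5,qB,qB), (q7,q9,q3),
    (q8,q8,q2), (qA,q5,q5), (qC,qE,qE), (qE,q7,qD)],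
   [(q2,q7,qA), (q5,qB,qC), (q6,q6,q1), (qA,q2,q4), (qB,qE,qE),
    (qC,q4,q2), (qD,qC,q7), (qE,q3,q5), (qF,qD,qD)],
   [(q1,qB,qB), (q2,qA,q5), (q3,qD,qA), (q4,qC,q3), (q6,q6,q1),
    (qA,q9,qC), (qB,q4,q7), (qD,qE,q9), (qE,q5,q4)],
   [(q2,q4,q1), (q3,qE,q4), (q6,q1,q8), (q6,qC,qD), (q7,q9,qA),
    (q8,q3,q3), (q9,q1,qD), (qC,q6,qF), (qD,qB,q6)],
   [(q4,q6,q8), (q5,qE,q5), (q6,q4,qB), (q6,qF,qF), (q7,qF,qB),
    (q8,q5,q2), (q9,q7,qC), (qA,qC,q1), (qB,qD,q6)],
   [(q1,q6,q2), (q3,qC,q7), (q4,q1,q6), (q5,q8,qE), (q6,q5,qB),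
    (q8,qA,q3), (q9,qD,q1), (qA,qE,qD), (qE,qF,q9)],
   [(q1,qC,q6), (q2,q4,q5), (q3,q9,q1), (q6,q1,qC), (q7,qE,q2),
    (q9,q8,qD), (qA,q2,q9), (qC,q3,q7), (qE,q7,qF)],
   [(q2,q1,qB), (q3,q4,q6), (q6,qC,q3), (q9,qF,q1), (qA,qB,qD),
    (qB,qE,q9), (qC,q8,q5), (qD,q6,qA), (qE,qD,q4)],
   [(q2,qA,qE), (q4,q5,q7), (q5,q7,q1), (q6,qF,qA), (q7,q8,qB),
    (q9,qE,q3), (qA,qC,q4), (qE,q9,q8), (qF,q4,q6)],
   [(q2,qD,qB), (q4,q8,q4), (q5,qC,q6), (q6,q4,q2), (q7,q1,q1),
    (qA,qF,qD), (qB,q6,qC), (qD,qE,qE), (qE,qB,q5)],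
   [(q2,q4,qC), (q4,qA,qE), (q5,q2,q6), (q8,q7,qD), (qB,q1,q1),
    (qC,qD,q7), (qD,q8,q8), (qE,q9,q3), (qF,q6,q4)],
   [(q2,qC,qB), (q5,qB,q6), (q6,q1,qA), (qA,q4,q8), (qB,q6,q3),
    (qC,qE,qD), (qD,q8,q9), (qE,qD,qF), (qF,qF,q7)],
   [(q1,q2,qB), (q2,qE,q9), (q5,q3,q1), (q6,q7,q5), (q7,qA,q8),
    (q8,qF,qF), (qA,q1,q7), (qB,q4,q4), (qE,q8,q2)],
   [(q3,q7,q1), (q4,qE,qD), (q6,qF,q4), (q8,q1,qF), (q9,qC,q8),
    (qA,qB,q7), (qB,q6,q3), (qE,q2,q5), (qF,q4,qE)],
   [(q2,q9,q2), (q3,q5,q4), (q5,qA,q8), (q6,qF,q7), (q7,q3,q5),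
    (q8,q7,qE), (q9,q2,qF), (qA,q4,qB), (qE,qB,q6)],
   [(q2,q9,q6), (q5,qC,q4), (q6,qB,q5), (q8,q5,q9), (q9,q8,qF),
    (qC,qE,qB), (qD,qA,q3), (qE,q4,q8), (qF,q3,q1)],
   [(q2,qB,qD), (q3,q3,q6), (q4,qD,q9), (q5,q7,qC), (qA,q3,q7),
    (qA,q9,q6), (qB,qF,q8), (qC,q5,q2), (qD,q1,q3)],
   [(q2,q3,qF), (q3,q6,q2), (q4,qE,qC), (q5,q8,qE), (q6,qD,q5),
    (q8,q4,q4), (qA,q7,q9), (qB,qC,q6), (qF,q1,q1)],
   [(q1,q6,q5), (q3,qA,q6), (q4,qB,q7), (q8,q9,qB), (qA,qC,qA),
    (qB,q8,qF), (qC,q2,q9), (qD,qF,q1), (qE,q7,q2)],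
   [(q1,q1,q7), (q2,qC,qF), (q3,qD,q6), (q4,qE,qB), (q6,qF,qC),
    (qA,q4,qD), (qB,q8,qE), (qD,q6,q2), (qE,qB,q8)],
   [(q2,qF,q7), (q3,q5,q1), (q6,q9,q4), (q8,q1,q8), (q9,q2,qF),
    (qA,qE,qE), (qD,qC,q5), (qE,q8,q3), (qF,qA,qD)],
   [(q2,qC,qD), (q3,q2,qF), (q5,q3,q5), (q6,q1,q7), (q7,qA,q8),
    (q8,q9,q9), (q9,q5,q4), (qA,q7,q3), (qE,qD,q6)],
   [(q1,qC,q9), (q2,qD,q7), (q5,q9,q1), (q6,q1,q5), (q7,q4,qF),
    (q8,qF,q8), (qC,qE,qB), (qD,q6,q2), (qE,qA,q4)],
   [(q1,q5,q1), (q3,q4,q5), (q4,qE,qD), (q6,qD,q4), (q7,q8,q8),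
    (q8,q3,qE), (qA,q7,q6), (qB,q2,q2), (qE,qC,qF)],
   [(q2,q5,q7), (q2,q7,q6), (q3,q9,qA), (q4,q3,q3), (q5,q5,q6),
    (qA,qD,qB), (qB,qF,q2), (qC,qB,qE), (qD,q1,qF)],
   [(q1,qF,q1), (q2,q9,qE), (q3,q8,q9), (q5,q6,q3), (q6,qB,q4),
    (q8,qC,q5), (qA,q5,q8), (qC,qE,qA), (qD,q4,q6)],
   [(q1,qC,q6), (q4,qD,q7), (q6,q2,qF), (q8,q9,qA), (q9,q8,qC),
    (qA,q6,q8), (qB,q1,q1), (qD,qE,q2), (qE,qB,q3)],
   [(q2,q9,qD), (q3,q4,q4), (q7,q1,q3), (q8,q7,qF), (qA,qA,q8),
    (qB,q8,qA), (qC,qD,q9), (qD,qB,q2), (qE,qF,qC)],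
   [(q2,qA,q5), (q3,q6,q3), (q5,qF,qE), (q8,q2,qB), (qA,q3,qD),
    (qB,qB,qF), (qC,q1,qA), (qE,q4,q2), (qF,qC,q9)],
   [(q1,q9,q5), (q3,q8,qF), (q4,qE,qB), (q6,q3,q8), (q9,qF,q2),
    (qB,q5,q6), (qC,q2,q1), (qE,q4,q2), (qE,qF,qC)],
   [(q2,q9,q5), (q3,qF,qB), (q4,qC,q3), (q8,q5,q4), (qA,q3,q8),
    (qB,qE,q9), (qD,q4,qC), (qE,qB,qE), (qF,qD,qA)],
   [(q1,qD,q1), (q2,qC,q2), (q3,q8,qE), (q4,q9,q6), (q6,q5,qA),
    (q9,q6,q5), (qA,q2,qB), (qE,qB,q8), (qF,qA,q7)],
   [(q1,q3,q9), (q2,q1,q6), (q4,qA,qA), (q5,q2,q3), (q6,q4,qB),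
    (q9,qB,qC), (qC,q6,q2), (qE,qC,q7), (qF,qF,q4)],
   [(q1,q2,q7), (q2,qA,qD), (q5,q8,q9), (q6,q3,qC), (q7,q6,q4),
    (qA,q4,q3), (qC,q7,q6), (qE,qD,qF), (qF,qB,q1)],
   [(q1,q1,q5), (q3,qA,q2), (q4,q6,q3), (q6,qC,qD), (q7,qD,qA),
    (qA,qF,q6), (qC,q2,qC), (qE,q4,q7), (qF,q5,qE)],
   [(q1,qB,q9), (q2,q5,qE), (q7,q8,q6), (q9,q6,q7), (qA,q4,q5),
    (qB,q3,qC), (qD,q9,q4), (qE,q2,q8), (qF,qC,q3)],
   [(q3,q2,q4), (q4,qF,qD), (q5,q9,qB), (q6,q4,qA), (q7,qD,q2),
    (q9,q1,q8), (qB,q8,q7), (qC,qA,q3), (qD,qE,q6)],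
   [(q3,q6,qB), (q6,q2,q8), (q7,q9,q7), (q8,qF,qD), (q9,qE,qF),
    (qA,qA,q1), (qB,q3,q6), (qC,q8,q2), (qE,qD,q3)],
   [(q1,qE,qC), (q2,q8,q8), (q3,q6,q7), (q6,q9,q3), (q7,q5,qF),
    (q9,qA,qA), (qB,q2,qD), (qC,qF,q6), (qF,qB,qE)],
   [(q1,qD,q9), (q4,q1,q6), (q5,q6,q7), (q6,q7,q2), (q7,q2,qC),
    (q9,q3,q8), (qA,q8,qF), (qD,qA,qB), (qF,qE,qA)],
   [(q4,qE,qC), (q6,qD,qA), (q7,q6,q5), (q8,q4,q4), (qA,q7,q6),
    (qB,q2,q7), (qD,q8,q8), (qE,q9,qF), (qF,q5,q1)],
   [(q1,qA,q9), (q2,qE,qC), (q3,q9,q5), (q6,q8,q8), (q7,qD,qF),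
    (q8,q2,qD), (qA,q3,q3), (qC,q6,q2), (qF,qF,qB)],
   [(q1,q1,qD), (q2,q5,q2), (q4,q6,q3), (q5,q7,q4), (q6,q8,qF),
    (q8,qA,qB), (q9,qB,q8), (qA,qE,qA), (qF,q2,qE)],
   [(q2,qC,qF), (q4,q2,qA), (q7,q4,q7), (q8,q3,qB), (q9,q5,q1),
    (qA,qF,q6), (qB,q6,q2), (qE,qD,q4), (qF,q8,q8)],
   [(q1,q1,q5), (q3,qF,qE), (q4,q1,q4), (q4,q5,q5), (q6,q3,q7),
    (q9,q7,qC), (qB,qD,q6), (qC,q9,qF), (qE,qB,qD)],
   [(q2,q9,q3), (q3,q6,q2), (q5,q8,q8), (q6,qA,qA), (q7,q1,q1),
    (q8,q3,qD), (qA,qE,qC), (qB,q4,q6), (qC,q5,q5)],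
   [(q1,qF,q1), (q2,q7,q2), (q4,q9,q4), (q5,q6,qC), (q7,qE,q9),
    (q8,qD,q8), (q9,q2,q6), (qA,qC,q3), (qE,qA,qF)],
   [(q2,q9,q6), (q3,qC,q7), (q5,qE,q2), (q8,qB,q5), (q9,qD,qD),
    (qA,qF,q4), (qC,q3,q8), (qD,q5,qC), (qE,q4,qB)],
   [(q1,qA,q1), (q4,q1,q5), (q7,q9,q9), (q9,q2,q4), (qB,q6,qF),
    (qC,qE,q2), (qD,q3,q3), (qE,qC,qC), (qF,q7,qB)],
   [(q2,q5,qB), (q3,qB,q9), (q5,qC,qF), (q9,qF,qC), (qA,q4,qE),
    (qB,q6,q7), (qD,q9,q4), (qE,qE,qA), (qF,q8,q6)],
   [(q3,q4,q8), (q4,q3,qD), (q5,qF,q3), (q6,q2,q4), (q7,q8,q5),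
    (q9,q6,q1), (qB,q1,q2), (qC,q9,qA), (qD,qC,qE)],
   [(q1,q6,q7), (q2,qE,q3), (q3,qA,q4), (q6,q3,qB), (q7,q2,q1),
    (q9,qD,qE), (qA,q7,q9), (qD,q5,qF), (qF,qC,q2)],
   [(q1,qB,q9), (q2,q9,qA), (q3,q2,qC), (q4,q3,q4), (q5,q6,qE),
    (q9,qE,q1), (qB,q7,q8), (qD,q4,q3), (qE,q8,qF)],
   [(q1,q6,qB), (q2,qB,qA), (q4,q3,q5), (q5,q9,q1), (q6,q8,q9),
    (q8,qC,qD), (qA,q7,q8), (qB,qA,q6), (qD,qE,qF)],
   [(q1,q5,qB), (q2,q4,q8), (q4,qB,qC), (q5,qE,q5), (q6,q2,q3),
    (qB,qA,q7), (qC,q8,q6), (qD,qD,qA), (qE,q9,q2)],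
   [(q1,q8,qF), (q2,q1,q6), (q7,q3,q1), (q8,q5,qD), (q9,qC,q7),
    (qA,q4,q8), (qC,qA,qC), (qD,q6,q3), (qE,qB,q5)],
   [(q1,q9,qD), (q4,qE,q3), (q7,qA,q5), (q9,q7,qE), (qB,q5,q2),
    (qC,qF,q4), (qD,q6,q8), (qE,q4,qA), (qF,q2,q1)],
   [(q1,q8,q6), (q2,qC,q9), (q3,q4,q8), (q5,qD,qE), (q7,q1,qA),
    (qA,q3,qD), (qB,q7,q5), (qD,q6,q7), (qE,qE,qC)],
   [(q4,q7,q8), (q5,q1,q9), (q6,q5,q7), (q7,q9,qA), (qC,q3,q4),
    (qC,qF,q5), (qD,qB,q6), (qE,qD,qB), (qF,qF,q4)],
   [(q2,qE,qA), (q3,q8,qF), (q4,q3,q4), (q5,q6,q3), (q6,q2,qC),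
    (q8,q5,qB), (q9,qF,q1), (qA,q7,q2), (qD,qC,q6)],
   [(q2,q4,q2), (q3,q6,qA), (q7,qA,q6), (q8,qB,qF), (q9,qE,qE),
    (qA,q9,q3), (qC,q7,q5), (qE,q2,q8), (qF,q1,q1)],
   [(q2,q1,q5), (q3,qE,q3), (q4,q5,qF), (q5,q4,q7), (q7,qB,qB),
    (q8,qD,q4), (qA,q7,q6), (qB,q3,qA), (qE,qC,qD)],
   [(q2,q9,qF), (q3,q7,q1), (q6,q8,qE), (q8,q4,qB), (qA,qD,qC),
    (qB,qE,q8), (qC,q5,q4), (qD,q2,q6), (qF,q6,qD)],
   [(q3,qE,q4), (q4,q8,q6), (q6,qA,q2), (qA,qC,qF), (qB,qB,qC),
    (qC,qD,qA), (qD,q2,q7), (qE,q7,q3), (qF,q3,qD)],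
   [(q3,q6,q9), (q5,qA,qA), (q7,qE,q1), (qA,q7,qC), (qB,qC,q2),
    (qC,q5,q5), (qD,q9,qF), (qE,q8,q8), (qF,qD,qE)],
   [(q3,q1,q2), (q4,q7,qC), (q5,qC,qF), (q6,qA,q5), (q7,q6,q1),
    (q9,q8,q4), (qB,q4,q9), (qC,q5,qB), (qD,qF,q3)],
   [(q1,q4,q3), (q2,q9,qE), (q5,q2,q5), (q6,q5,qD), (q7,qB,q9),
    (q9,qA,q1), (qA,qE,q2), (qB,q3,q8), (qF,q6,q7)],
   [(q1,qB,qD), (q3,q3,qF), (q7,qC,q3), (q8,q4,q5), (q9,q5,q7),
    (qA,q7,qB), (qC,qA,qC), (qD,q1,q2), (qF,q9,q6)],
   [(q1,qE,q1), (q3,qC,q3), (q5,q6,q7), (q6,q5,q4), (q7,qA,qB),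
    (q9,qD,qE), (qA,q1,q9), (qB,qF,qF), (qE,q8,q2)],
   [(q1,q3,q5), (q2,qF,q2), (q3,qA,q7), (q5,q8,qF), (q6,q6,q1),
    (q8,qB,qC), (qA,q4,qB), (qC,q2,qD), (qD,q5,q4)],
   [(q8,q7,q3), (q8,qE,qC), (q9,q1,q5), (qA,qB,qA), (qB,q2,qE),
    (qC,q4,q1), (qD,q7,qC), (qE,q8,q7), (qF,qD,q8)],
   [(q2,qC,q8), (q5,q4,q5), (q6,qB,q4), (q8,qD,qF), (q9,qF,q1),
    (qA,q1,q6), (qB,q8,q9), (qC,qA,qB), (qD,q2,q3)],
   [(q1,qC,q4), (q2,q3,qA), (q3,q2,qE), (q4,q8,q6), (q5,q1,q1),
    (q8,q6,q3), (qA,q5,qD), (qD,qA,qC), (qE,qD,q5)],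
   [(q1,qB,q7), (q4,q4,qB), (q5,qD,qE), (q6,q9,qA), (q7,q8,q3),
    (q9,q2,qD), (qB,q7,q8), (qD,qC,q2), (qE,qA,qC)],
   [(q1,q5,q5), (q2,q4,q4), (q3,qE,q1), (q4,q2,q8), (q7,qF,qA),
    (qA,q3,q6), (qB,q6,q7), (qD,qC,qD), (qF,qB,qE)],
   [(q1,q4,q1), (q3,qA,qB), (q4,qE,qC), (q6,q1,q5), (q7,q5,qF),
    (q9,qC,qD), (qA,q3,q6), (qB,q6,q9), (qF,qD,qE)],
   [(q1,q7,q6), (q2,q9,qD), (q4,q2,qA), (q5,q5,q8), (q7,q3,q7),
    (q8,qC,q4), (q9,q4,q2), (qB,qF,q3), (qF,qD,qB)],
   [(q2,qF,qE), (q3,q6,q7), (q5,q4,q2), (q6,q3,q5), (q7,qB,q9),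
    (q9,q2,qD), (qD,q1,q8), (qE,q8,q3), (qF,qE,q1)],
   [(q1,qB,qF), (q2,qD,qC), (q4,qC,q1), (q7,qF,q4), (q8,q9,q2),
    (q8,qE,qA), (qB,q9,qA), (qD,qA,q9), (qE,q8,q7)],
   [(q2,qC,qD), (q3,q8,q8), (q4,qA,qB), (q5,q2,q7), (q6,q6,q1),
    (q8,qD,qA), (qA,q1,q3), (qB,q3,q5), (qF,q5,q4)],
   [(q2,qF,q6), (q3,qC,q4), (q4,q2,qD), (q6,qD,q5), (q7,q1,q1),
    (q8,qB,q8), (qA,q4,qF), (qB,qA,q2), (qD,q8,qE)],
   [(q2,q3,qB), (q3,qF,q1), (q5,qA,q9), (q8,q6,q2), (qA,q5,qC),
    (qB,q2,qA), (qC,q8,q6), (qE,qB,q4), (qF,q4,q5)],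
   [(q3,qB,q9), (q6,q7,qC), (q7,qA,qB), (q9,q8,q2), (qB,q4,q3),
    (qC,qC,qD), (qD,q9,qF), (qE,q2,qA), (qF,qD,q7)],
   [(q1,qD,q9), (q2,q5,q6), (q5,qE,q1), (q9,q1,qC), (qA,qC,q5),
    (qB,q4,qB), (qC,qA,qF), (qD,q6,q7), (qF,q3,q4)],
   [(q1,qB,q9), (q2,q5,q6), (q5,q2,qD), (q6,qF,q4), (q7,q4,qB),
    (q9,q3,q8), (qC,qE,qA), (qD,q6,qE), (qF,qC,q1)],
   [(q1,q2,q5), (q4,q4,q4), (q7,qE,q7), (q9,q8,q1), (qB,qD,qC),
    (qC,q7,qA), (qD,qC,qF), (qE,qF,q3), (qF,q9,qD)],
   [(q2,q3,qE), (q3,qE,q1), (q5,q6,q7), (q6,q9,qF), (q7,q5,q2),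
    (q9,q2,qD), (qA,qF,qB), (qB,q1,qA), (qD,qB,q9)],
   [(q8,qD,qE), (q9,q5,q1), (qA,q1,q4), (qB,qB,q7), (qC,q9,q8),
    (qD,qF,qD), (qE,q3,qB), (qF,q7,q8), (qF,q9,q2)],
   [(q4,q5,qB), (q5,q8,q8), (q6,q9,qF), (q7,q6,qE), (q8,qB,q9),
    (q9,q7,qC), (qA,qA,qA), (qB,q4,qB), (qB,q5,qD)],
   [(q1,qB,q7), (q5,qF,qA), (q7,q1,q6), (q9,qA,qB), (qA,qC,q5),
    (qC,q9,q2), (qD,qD,qE), (qE,q4,qD), (qF,q3,q4)],
   [(q5,q6,q7), (q6,qA,q9), (q7,q1,qC), (q9,q3,q8), (qA,q5,q5),
    (qB,q7,qD), (qD,qD,qE), (qE,q8,qA), (qF,q9,q6)],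
   [(q1,q4,qA), (q3,qC,qC), (q4,q2,q3), (q5,q6,q6), (q7,qE,qB),
    (q9,q1,qE), (qA,q9,qD), (qB,qF,qF), (qC,q5,q4)],
   [(q1,q7,q6), (q2,q3,q4), (q3,q6,q7), (q6,q2,qE), (q7,q5,qF),
    (q9,qF,qA), (qB,qB,q9), (qD,q9,qB), (qE,q8,qC)],
   [(q2,q7,qB), (q3,q6,q6), (q4,q3,q5), (q5,q4,qA), (q7,qF,q9),
    (q9,qE,qD), (qC,qA,q2), (qD,q1,q8), (qF,qC,qC)],
   [(q1,q5,q5), (q2,q4,q4), (q3,q1,qC), (q4,q7,q3), (q7,q2,qD),
    (q9,qF,q6), (qB,qB,q9), (qE,qC,qB), (qF,qD,q7)],
   [(q2,q7,q3), (q3,q5,q1), (q7,q8,qA), (q8,q1,qC), (q9,q4,q7),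
    (qA,q6,q8), (qC,qD,q4), (qE,qA,qD), (qF,qE,q2)],
   [(q1,q5,qF), (q2,qE,q9), (q5,q2,q5), (q6,q7,qA), (q7,qC,q2),
    (q9,q8,q4), (qA,q1,q6), (qB,q6,q7), (qF,qD,qE)],
   [(q1,q2,q9), (q3,qC,q3), (q5,q8,q1), (q8,qA,q8), (q9,qD,qC),
    (qB,qE,qB), (qC,q5,q6), (qE,q3,qF), (qF,q9,qD)],
   [(q1,qE,q3), (q2,q6,qF), (q4,qB,q5), (q5,q3,q1), (q7,qC,q7),
    (q8,qF,qA), (q9,q8,qC), (qA,q9,q2), (qE,q2,qB)],
   [(q1,qB,q9), (q2,qF,q6), (q3,qA,q4), (q6,q9,qC), (q7,q8,q5),
    (q9,q4,q3), (qA,qE,qE), (qD,q6,q7), (qF,q3,q8)],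
   [(q1,q7,qB), (q3,q8,q1), (q4,q3,q6), (q5,q4,q2), (q7,qB,qA),
    (q8,q2,qF), (qD,qE,qD), (qE,q5,q8), (qF,qA,qE)],
   [(q1,q9,q1), (q4,q7,qE), (q5,qE,q4), (q6,q3,qA), (q7,qA,q6),
    (q8,qC,qD), (qA,qF,q8), (qC,q2,q9), (qF,q8,qB)],
   [(q1,q6,qB), (q2,qE,q7), (q3,qD,q1), (q4,q2,q2), (q5,qA,q9),
    (q8,q5,qF), (qA,qB,q3), (qC,q7,q4), (qF,q4,qE)],
   [(q1,qC,q9), (q2,qD,q2), (q3,q2,qE), (q4,q9,q5), (q5,qB,q1),
    (q8,q3,q8), (qA,qE,q7), (qC,qA,q3), (qF,q6,qD)],
   [(q1,q8,qD), (q2,q1,qF), (q3,qE,q5), (q4,qA,qE), (q6,q5,qC),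
    (q8,q4,qB), (q9,q2,q6), (qC,q9,q9), (qF,q7,q1)],
   [(q2,q5,qD), (q3,q6,qC), (q4,q9,q2), (q5,q1,q9), (q6,q3,q1),
    (q8,q4,q4), (q9,qD,q6), (qE,qE,q7), (qF,qF,qE)],
   [(q1,qE,qB), (q2,q7,q7), (q3,q9,q9), (q4,q2,qD), (q5,qA,qA),
    (q8,qC,q5), (qB,q3,qC), (qD,q1,q4), (qF,q6,qF)],
   [(q1,q3,qC), (q3,q7,qD), (q4,q6,q2), (q5,q5,q8), (q6,qF,qF),
    (q9,qD,qB), (qD,qB,q3), (qE,qA,q6), (qF,q4,qA)],
   [(q2,q7,q2), (q3,q3,q7), (q6,qD,qE), (q7,q5,q1), (qA,q9,qB),
    (qB,qF,q8), (qE,qB,q4), (qF,q1,q2), (qF,q7,qD)],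
   [(q2,qF,q4), (q3,qB,q2), (q6,q3,qF), (q7,q2,q4), (q7,qF,q3),
    (qA,qA,q5), (qB,q6,qE), (qE,q7,q8), (qF,qE,q9)],
   [(q1,qC,q2), (q3,qD,qC), (q5,qE,q7), (q9,q5,q8), (qA,qF,q4),
    (qB,q8,q1), (qC,qB,qB), (qD,q7,q5), (qE,q1,qA)],
   [(q1,qA,q4), (q3,qC,qC), (q5,qE,q1), (q6,q7,q2), (q7,q6,q6),
    (q9,qB,qE), (qC,q5,q9), (qD,qF,qF), (qE,q8,q5)],
   [(q1,q1,qE), (q3,qA,q4), (q5,q9,qB), (q8,q2,q3), (qA,qC,qA),
    (qB,qD,q7), (qC,q3,qC), (qD,q7,q6), (qF,q5,q5)],
   [(q1,qC,qE), (q2,qE,q8), (q4,q7,qF), (q5,qB,q9), (q7,qA,q1),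
    (q9,qF,qA), (qD,q8,q4), (qE,q2,qD), (qF,q1,q2)],
   [(q1,qE,q7), (q2,qC,q9), (q3,q2,q4), (q4,q1,qF), (q5,q3,qB),
    (q9,qB,qA), (qA,q5,q2), (qD,q8,q5), (qF,q4,q3)],
   [(q3,q8,q1), (q5,q2,q9), (q7,qE,q6), (q8,qA,q8), (q9,qD,qC),
    (qC,q7,qB), (qD,qB,qD), (qE,q3,q2), (qF,qC,qE)],
   [(q1,qA,q1), (q4,qF,qF), (q5,q4,qB), (q6,q6,q4), (q7,qC,qC),
    (q9,q7,q3), (qB,q8,q5), (qC,q5,q9), (qF,q1,q2)],
   [(q1,q5,q5), (q3,q6,qF), (q5,q9,q6), (q8,q3,qA), (q9,q2,qD),
    (qA,q4,qE), (qD,qC,qC), (qE,qE,qB), (qF,qD,q2)],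
   [(q1,q4,q3), (q5,q3,qC), (q6,qC,qF), (q9,q8,q1), (qB,qA,q4),
    (qC,q6,qD), (qD,qB,qA), (qE,q9,q5), (qF,qD,q7)],
   [(q2,q3,q2), (q3,qE,q7), (q5,qF,q9), (q8,q4,q6), (q9,qD,q5),
    (qB,qA,qE), (qC,qC,q3), (qD,qB,qD), (qF,q6,qF)],
   [(q1,q2,q1), (q2,q4,qE), (q5,q9,q6), (q8,q1,qD), (q9,q3,q7),
    (qB,q6,qF), (qD,q8,q5), (qE,qD,q2), (qF,qE,qB)],
   [(q3,q1,q2), (q4,q7,qF), (q5,q8,q4), (q6,qE,q5), (q7,q6,q1),
    (q9,q3,q3), (qB,qC,qC), (qC,qD,qB), (qD,q4,q9)],
   [(q1,q8,q5), (q3,q5,q2), (q4,qF,q7), (q5,q7,qB), (q6,qC,q9),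
    (q9,qE,qD), (qA,q4,q3), (qB,q2,q4), (qD,q1,q8)],
   [(q1,q6,qE), (q3,qC,qF), (q5,q3,qC), (q8,q2,q3), (q9,q4,q2),
    (qA,qA,q4), (qD,q1,qA), (qE,q9,q5), (qF,qD,q7)],
   [(q1,q6,q6), (q3,qD,q2), (q4,qF,q7), (q5,q9,qB), (q7,q2,q4),
    (qA,qC,qA), (qC,qA,qF), (qD,q1,q8), (qF,q8,q1)],
   [(q1,q7,qB), (q3,q1,qA), (q5,qA,qE), (q8,qC,q9), (q9,q4,q8),
    (qA,qD,qC), (qD,qE,q7), (qE,qF,q4), (qF,q8,q1)],
   [(q1,q8,q2), (q2,qB,qF), (q3,q7,qD), (q4,qA,q8), (q5,q2,q5),
    (q9,qF,qC), (qB,qE,q6), (qC,q9,q4), (qF,q4,q3)],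
   [(q8,q3,qF), (q9,q6,q7), (q9,q7,q3), (qA,qE,qB), (qB,q2,qE),
    (qC,qF,q6), (qD,qA,qA), (qE,q6,q3), (qF,qB,q2)],
   [(q1,q3,qF), (q1,qB,qD), (q3,q5,q1), (q4,q9,qB), (q6,q3,qD),
    (q8,q7,q3), (qA,qF,q9), (qD,qD,q5), (qF,q1,q7)],
   [(q1,qE,qC), (q3,q1,q2), (q5,qB,q4), (q6,qA,q9), (q7,q4,q8),
    (q8,q7,qF), (q9,q3,q7), (qB,q2,qD), (qC,qC,qE)],
   [(q1,qD,q5), (q2,q3,qA), (q3,qA,qE), (q4,q4,q6), (q5,q9,q4),
    (q9,q6,q1), (qA,q5,q8), (qD,q2,qD), (qF,q8,q7)],
   [(q1,qE,q1), (q3,q5,q5), (q4,qD,q2), (q5,q4,qA), (q6,q1,q3),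
    (qB,q7,qD), (qC,q9,qC), (qD,q6,q7), (qF,qB,q9)],
   [(q1,q4,qB), (q2,q1,qF), (q3,q9,q9), (q5,q2,qD), (q6,q3,qC),
    (q8,qC,q5), (q9,q8,q6), (qD,qE,q7), (qF,q7,q8)],
   [(q1,q2,q4), (q2,q6,qD), (q5,q3,qC), (q6,q1,qE), (q7,q5,q5),
    (q8,qA,q6), (q9,qD,q2), (qB,qB,q9), (qD,qF,q3)],
   [(q1,q6,qE), (q3,q9,q9), (q4,qF,q7), (q5,qC,q1), (q6,q5,qB),
    (qB,q2,q4), (qC,q8,q5), (qD,q7,q8), (qF,q4,q3)],
   [(q1,qC,q2), (q2,qF,q8), (q4,q4,q9), (q7,q1,q7), (q9,q2,q8),
    (q9,qF,q6), (qA,q9,qD), (qC,q7,q3), (qF,qA,qC)],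
   [(q1,qD,qE), (q4,q8,qA), (q5,q5,q2), (q6,q2,q6), (q7,q4,q8),
    (q8,q7,q5), (qB,q3,qB), (qD,q9,qF), (qF,qB,q9)],
   [(q1,q2,q8), (q5,qC,q2), (q7,q3,qC), (q8,q6,q9), (qB,q8,q1),
    (qC,qB,qB), (qD,q9,qD), (qE,qF,qE), (qF,qE,q6)],
   [(q4,q8,qA), (q5,qC,qF), (q7,qD,q7), (q8,q4,q3), (q9,q2,q8),
    (qB,q3,qB), (qD,q5,qD), (qE,qF,qE), (qF,q6,q1)],
   [(q1,q4,q9), (q5,q8,q7), (q7,qD,q2), (q8,q1,qD), (q9,qB,q3),
    (qA,qE,q5), (qB,qA,qE), (qC,q9,q6), (qF,q6,qF)],
   [(q1,qA,q4), (q3,qB,qA), (q4,q5,qC), (q5,q4,q8), (q6,q2,q5),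
    (q9,qE,q6), (qD,q6,q1), (qE,qD,q3), (qF,q7,qB)],
   [(q1,q6,q8), (q3,q2,qC), (q5,q7,qE), (q8,q4,q4), (qA,q9,q7),
    (qB,qF,q5), (qC,qA,qB), (qD,q5,qA), (qF,qE,qD)],
   [(q1,qC,qC), (q3,q3,qF), (q5,q9,qB), (q6,q1,q8), (q7,qB,qD),
    (qB,qD,q2), (qC,q6,q3), (qE,q2,q6), (qF,q5,qA)],
   [(q1,q1,q9), (q3,qF,qE), (q5,q6,qA), (q6,q5,q1), (q7,qB,q6),
    (q8,qC,q5), (qA,q3,qB), (qC,q7,q3), (qE,qE,q7)],
   [(q2,q1,q5), (q3,qE,q7), (q4,qD,qD), (q5,qB,qA), (q7,q3,qF),
    (qB,q9,q4), (qD,q8,q1), (qE,qF,qC), (qF,q4,q3)],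
   [(q1,q9,qB), (q1,qF,q3), (q2,q7,qD), (q5,q5,q7), (q6,qB,q9),
    (q9,q3,q1), (qA,q9,q3), (qD,q1,qF), (qE,qD,q5)],
   [(q1,qE,qE), (q2,q2,q4), (q5,qD,q3), (q6,q5,q8), (q9,q1,q2),
    (q9,qA,q5), (qA,q1,q5), (qD,q6,q9), (qE,q9,qF)],
   [(q1,q4,q9), (q3,qA,qE), (q4,q9,qD), (q5,q8,q1), (q7,qB,qA),
    (q8,q2,qF), (q9,qE,q6), (qB,qD,qB), (qE,q5,q3)],
   [(q1,qC,q2), (q2,q3,q3), (q3,q5,qD), (q5,qA,q5), (q7,qD,qC),
    (qA,q4,qE), (qB,q8,q4), (qC,qF,q8), (qF,qE,q7)],
   [(q1,qB,q7), (q3,q5,qA), (q4,q6,qB), (q6,q4,q8), (q7,q8,q1),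
    (qB,qD,qC), (qD,q2,q5), (qE,q7,q4), (qF,qC,q2)],
   [(q1,q6,q8), (q3,q1,qE), (q4,q4,q2), (q5,qE,q7), (q7,qB,q4),
    (q8,qC,q6), (qA,q5,q3), (qB,qD,qB), (qD,q2,q9)],
   [(q1,qF,q3), (q3,qC,qD), (q4,q3,qE), (q6,q6,q5), (q7,q9,q2),
    (q9,q4,qA), (qC,q1,q8), (qD,q8,q4), (qF,q2,q1)],
   [(q1,qB,q3), (q2,qC,q9), (q3,q7,q6), (q5,q6,q8), (q7,qA,qB),
    (q8,q5,qC), (qB,q4,qA), (qE,qE,qD), (qF,q3,q4)],
   [(q3,q8,q5), (q4,qB,qD), (q5,qF,q3), (q6,qE,q4), (q7,q5,q2),
    (q9,q6,q1), (qB,qC,qE), (qC,q9,q8), (qD,q4,qA)],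
   [(q1,qE,qD), (q3,q7,q6), (q7,q5,q7), (q8,qF,qB), (qA,qC,q9),
    (qB,q8,q4), (qD,q6,q8), (qE,qB,q3), (qF,qA,q1)],
   [(q3,qE,q1), (q4,q3,qE), (q5,q4,qA), (q6,q9,q3), (q7,qD,q9),
    (q9,q6,q6), (qB,q1,q8), (qE,q8,q4), (qF,q2,q5)],
   [(q1,q3,q4), (q2,q4,qC), (q3,q7,qD), (q4,q5,qA), (q5,q2,q5),
    (q8,qA,q2), (qB,q9,q6), (qD,qB,q7), (qF,qF,q9)],
   [(q1,qF,q3), (q3,qD,qE), (q7,q1,qC), (q9,q2,q1), (qA,qE,qF),
    (qB,q8,q5), (qC,q9,q8), (qE,qA,qB), (qF,q4,q9)],
   [(q1,q8,q1), (q2,qB,qA), (q3,q2,q9), (q5,qF,qC), (q7,qC,qF),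
    (q8,q4,qE), (qB,qE,q7), (qE,q1,q5), (qF,q9,qD)],
   [(q1,qC,q2), (q3,qA,q4), (q4,q7,q5), (q5,q9,qB), (q7,q1,qA),
    (qA,qD,q8), (qC,q2,qF), (qD,qE,q6), (qF,q8,q3)],
   [(q1,qD,q3), (q2,qE,qD), (q4,q1,q6), (q7,q6,q7), (q7,q9,q2),
    (q8,q5,q8), (qB,q2,qC), (qD,qA,q9), (qE,q6,q2)],
   [(q1,qF,q7), (q2,q1,qE), (q5,q3,q1), (q6,q5,qB), (q8,q9,q2),
    (qB,qB,q4), (qC,q7,qD), (qF,q5,q8), (qF,qD,qB)],
   [(q3,qD,q5), (q4,q4,q9), (q5,qF,q3), (q6,q2,qE), (q7,q5,q7),
    (q8,q9,q8), (q9,qC,qF), (qD,qA,qB), (qF,qE,qA)],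
   [(q1,q8,q7), (q2,q3,qF), (q3,q7,q5), (q5,q2,q9), (q7,q6,q1),
    (qA,q5,qC), (qB,qA,qB), (qC,qC,q6), (qF,qB,q4)],
   [(q2,qC,q2), (q3,q9,qD), (q5,q3,q3), (q6,q4,qE), (q7,qE,qB),
    (qB,qF,qF), (qC,q1,q7), (qD,qA,q5), (qF,q8,q4)],
   [(q1,qB,q7), (q2,q2,q5), (q3,q5,qA), (q5,q4,q8), (q7,qC,q3),
    (q8,qA,q2), (qB,qF,qC), (qE,q7,q4), (qF,q6,q9)],
   [(q1,q8,q1), (q2,q4,qC), (q3,q7,qD), (q4,q2,q8), (q5,qB,q3),
    (q9,qA,q5), (qB,qF,qF), (qC,q1,q7), (qF,q6,q6)],
   [(q1,qD,qE), (q3,qC,qC), (q4,q7,qA), (q5,q3,q4), (q6,qF,q2),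
    (qB,q6,q7), (qC,qB,q3), (qD,q9,qB), (qF,qE,q1)],
   [(q1,q9,qF), (q3,qA,qB), (q5,q7,qE), (q6,q5,qA), (q7,q8,q6),
    (q8,q4,q4), (qA,qF,q8), (qB,qE,q7), (qF,qC,qD)],
   [(q3,q5,qA), (q6,qF,q9), (q7,qB,q3), (q8,q2,q6), (q9,q3,q4),
    (qA,q6,qB), (qB,q1,q2), (qD,qD,qE), (qF,qA,q5)],
   [(q1,qC,q2), (q3,q4,q1), (q4,q8,q4), (q5,q7,qE), (q6,q3,qD),
    (qB,q9,qF), (qC,q1,q7), (qD,qA,q5), (qF,q6,q9)],
   [(q1,q6,q8), (q2,qE,q4), (q3,q8,q7), (q4,q7,q6), (q7,qD,q2),
    (q8,qF,qB), (q9,qB,q3), (qD,q2,q9), (qF,qC,qE)],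
   [(q1,q9,qD), (q3,qC,qF), (q5,qD,qC), (q6,qA,q4), (q7,qE,q6),
    (qB,q6,q1), (qC,q3,qA), (qE,qB,q2), (qF,q2,q5)],
   [(q1,qD,qE), (q3,q3,q3), (q6,qA,q6), (q8,q9,q4), (q9,qC,qF),
    (qB,q7,q8), (qC,q8,qC), (qD,q5,qD), (qF,qB,q9)],
   [(q1,q2,qA), (q2,q7,qB), (q4,q9,q2), (q7,q1,q6), (q7,qA,qF),
    (q9,qF,q7), (qA,q1,qF), (qC,qC,qE), (qF,q4,q3)],
   [(q1,qE,q6), (q3,q4,q3), (q4,qD,qD), (q8,q6,qE), (q9,q5,qA),
    (qB,q7,qB), (qD,q8,q1), (qE,q1,q9), (qF,qA,qF)],
   [(q1,q6,q1), (q3,q4,q8), (q7,qA,qF), (q8,qC,q2), (q9,qB,q7),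
    (qB,q3,qB), (qC,q8,qC), (qD,q5,qD), (qE,q1,q9)]]"

section \<open>Evaluation of the search and of the listed tensors\<close>

lemma bit_code [code]:
  "0 + b = (b :: bit)" "1 + 0 = (1 :: bit)" "1 + 1 = (0 :: bit)"
  "0 * b = (0 :: bit)" "1 * b = (b :: bit)"
  by simp_all

text \<open>Both sides are evaluated by rewriting. This is the whole case analysis: it bounds the
  possible tables and at once attaches a decomposition to each.\<close>

lemma table_extensions_normalised:
  "table_extensions 4 normalised_columns = tensor_tables decompositions"
  by code_simp

lemma length_decompositions: "list_all (\<lambda>ts. length ts = 9) decompositions"
  by code_simp

lemma UNIV_quad: "set (subset_sums unit_quads) = UNIV"
proof -
  have "x \<in> set (subset_sums unit_quads)" for x
  proof (cases x)
    case (Quad a b c d)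
    then show ?thesis
      by (cases a; cases b; cases c; cases d) (simp_all add: unit_quads_def zero_quad_def)
  qed
  then show ?thesis by blast
qed

lemma independent_unit_quads: "independent_list unit_quads"
  by (simp add: unit_quads_def zero_quad_def)

lemma dot_add: "dot a (x + y) = dot a x + dot a y"
  by (cases a; cases x; cases y) (simp add: algebra_simps)

lemma biadditive_tensor_mult: "biadditive (tensor_mult ts)"
proof
  have "tensor_mult ts (x + x') y = tensor_mult ts x y + tensor_mult ts x' y \<and>
      tensor_mult ts y (x + x') = tensor_mult ts y x + tensor_mult ts y x'" for x x' y
  proof (induction ts)
    case (Cons t ts)
    obtain a b z where t: "t = (a, b, z)" by (cases t)
    have *: "(if (u + v) * w = 1 then z else 0) =
        (if u * w = 1 then z else 0) + (if v * w = 1 then z else 0)" for u v w :: bit and z :: quad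
      by (cases u; cases v; cases w) simp_all
    show ?case
      using Cons *[of "dot a x" "dot a x'" "dot b y"] *[of "dot b x" "dot b x'" "dot a y"]
      by (simp add: t dot_add mult.commute ac_simps)
  qed simp
  then show "tensor_mult ts (x + x') y = tensor_mult ts x y + tensor_mult ts x' y"
    "tensor_mult ts x (y + y') = tensor_mult ts x y + tensor_mult ts x y'" for x x' y y'
    by blast+
qed

lemma tensor_table_eq_map: "tensor_table ts xs ys = map (\<lambda>x. map (tensor_mult ts x) ys) xs"
proof -
  have "tensor_row ts x ys = map (tensor_mult ts x) ys" for x
    by (induction ys) auto
  then show ?thesis by (induction xs) auto
qed

lemma set_tensor_tables:
  "set (tensor_tables tss) = (\<lambda>ts. tensor_table ts unit_quads unit_quads) ` set tss"
  by (induction tss) auto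

text \<open>The identity and the two powers fix the entries that \<open>normalised_columns\<close>
  prescribes, so the search finds the table of \<open>m\<close>. A biadditive map is determined by
  its table on a basis.\<close>

lemma normalised_eq_tensor_mult:
  fixes m :: "quad \<Rightarrow> quad \<Rightarrow> quad"
  defines "e \<equiv> Quad 1 0 0 0" and "x \<equiv> Quad 0 1 0 0"
  assumes "nonsingular m" and unit: "\<And>y. m e y = y" "\<And>y. m y e = y"
    and powers: "m x x = Quad 0 0 1 0" "m x (m x x) = Quad 0 0 0 1"
  obtains ts where "length ts = 9" "m = tensor_mult ts"
proof -
  interpret nonsingular m by fact
  define A where "A = subset_sums unit_quads"
  have columns: "normalised_columns = [[A, A, A, [Quad 0 0 0 1]], [A, A, A, [Quad 0 0 1 0]],
      [A, [Quad 0 0 0 1], [Quad 0 0 1 0], [x]], [[Quad 0 0 0 1], [Quad 0 0 1 0], [x], [e]]]"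
    unfolding normalised_columns_def Let_def A_def[symmetric]
    by (simp add: unit_quads_def e_def x_def)
  have "set A = UNIV"
    by (simp add: A_def UNIV_quad)
  then have "list_all2 (\<lambda>x. list_all2 (\<lambda>y C. m x y \<in> set C) unit_quads) unit_quads normalised_columns"
    unfolding columns using unit powers by (simp add: unit_quads_def e_def x_def)
  then have "map (\<lambda>x. map (m x) unit_quads) unit_quads \<in>
      set (table_extensions (length unit_quads) normalised_columns)"
    by (intro table_in_table_extensions independent_unit_quads)
  moreover have "length unit_quads = 4"
    by (simp add: unit_quads_def)
  ultimately obtain ts where ts: "ts \<in> set decompositions"
    "map (\<lambda>x. map (m x) unit_quads) unit_quads = tensor_table ts unit_quads unit_quads"
    by (auto simp: table_extensions_normalised set_tensor_tables)
  have "m u v = tensor_mult ts u v" for u v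
  proof (rule biadditive_eqI[OF biadditive_axioms biadditive_tensor_mult])
    show "m u v = tensor_mult ts u v" if "u \<in> set unit_quads" "v \<in> set unit_quads" for u v
      using ts(2) that by (simp add: tensor_table_eq_map)
  qed (use UNIV_quad in auto)
  then have "m = tensor_mult ts"
    by blast
  moreover have "length ts = 9"
    using length_decompositions ts(1) by (simp add: list_all_iff)
  ultimately show ?thesis
    using that by blast
qed

section \<open>Upper bound\<close>

text \<open>Otherwise \<open>x x = x + e\<close> for all \<open>x\<close> outside \<open>{0, e}\<close>, and polarising gives
  \<open>x y + y x = e\<close> for all independent \<open>e, x, y\<close>, which is not additive in \<open>y\<close>.
  The span \<open>U\<close> of \<open>e, x, x x\<close> cannot contain \<open>x (x x)\<close>: else both \<open>x\<close> and \<open>x + e\<close> act bijectively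
  on \<open>U\<close> and hence as the identity on the quotient by \<open>U\<close>, which has order two.\<close>


lemma exists_cyclic:
  fixes m :: "'a::{char_two_group, finite} \<Rightarrow> 'a \<Rightarrow> 'a"
  assumes "nonsingular m" and card: "CARD('a) = 16"
    and unit: "\<And>y. m e y = y" "\<And>y. m y e = y"
  obtains x where "independent_list [m x (m x x), m x x, x, e]"
proof -
  interpret nonsingular m by fact
  \<comment> \<open>At most three vectors span at most eight of the sixteen elements.\<close>
  have outside: "\<exists>w. w \<notin> set (subset_sums cs)" if "length cs \<le> 3" for cs :: "'a list"
  proof (rule ccontr)
    assume "\<nexists>w. w \<notin> set (subset_sums cs)"
    then have "card (set (subset_sums cs)) = 16"
      using card by (metis UNIV_eq_I)
    moreover have "card (set (subset_sums cs)) \<le> 2 ^ length cs"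
      by (metis card_length length_subset_sums)
    moreover have "(2::nat) ^ length cs \<le> 2 ^ 3"
      using that by (intro power_increasing) auto
    ultimately show False by simp
  qed
  have e: "e \<noteq> 0"
    using outside[of "[]"] unit(1) by (metis empty_iff list.set(1) list.size(3) zero_left
      zero_le zero_in_subset_sums)
  have inv: "m x (x + e) \<noteq> 0 \<and> m (x + e) (x + e) \<noteq> 0 \<and> m x x \<noteq> 0" if "x \<noteq> 0" "x \<noteq> e" for x
    using that no_zero_divisors by (metis add_eq_0_iff_eq)
  have "\<exists>x. x \<noteq> 0 \<and> x \<noteq> e \<and> m x x \<noteq> x + e"
  proof (rule ccontr)
    assume "\<not> ?thesis"
    then have square: "m x x = x + e" if "x \<noteq> 0" "x \<noteq> e" for x
      using that by blast
    have polar: "m x y + m y x = e" if "independent_list [y, x, e]" for x y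
    proof -
      have "m (x + y) (x + y) = x + y + e" "m x x = x + e" "m y y = y + e"
        using that by (auto intro!: square simp: add_eq_0_iff_eq)
      then have "(x + e) + (m x y + m y x) + (y + e) = x + y + e"
        by (simp add: add_left add_right ac_simps)
      then show ?thesis
        by (simp add: ac_simps)
    qed
    obtain x where x: "x \<notin> set (subset_sums [e])"
      using outside[of "[e]"] by auto
    obtain y where y: "y \<notin> set (subset_sums [x, e])"
      using outside[of "[x, e]"] by auto
    obtain z where z: "z \<notin> set (subset_sums [y, x, e])"
      using outside[of "[y, x, e]"] by auto
    have "independent_list [y, x, e]" "independent_list [z, x, e]" "independent_list [y + z, x, e]"
      using e x y z by (auto simp: add_eq_0_iff_eq) (metis add_self_left)
    then have "m x y + m y x = e" "m x z + m z x = e" "m x (y + z) + m (y + z) x = e"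
      by (blast intro: polar)+
    moreover have "m x (y + z) + m (y + z) x = (m x y + m y x) + (m x z + m z x)"
      by (simp add: add_left add_right ac_simps)
    ultimately show False
      using e by simp
  qed
  then obtain x where x: "x \<noteq> 0" "x \<noteq> e" "m x x \<noteq> x + e"
    by blast
  define cs where "cs = [m x x, x, e]"
  define U where "U = set (subset_sums cs)"
  have "m x (x + e) = m x x + x" "m (x + e) (x + e) = m x x + e"
    by (simp_all add: add_left add_right unit ac_simps)
  \<comment> \<open>Together with \<open>m x x \<noteq> 0\<close> and the choice of
    \<open>x\<close>, this keeps \<open>m x x\<close> outside \<open>{0, e, x, x + e}\<close>, the
    span of \<open>x\<close> and \<open>e\<close>.\<close>
  then have "m x x \<noteq> x" "m x x \<noteq> e"
    using inv[OF x(1,2)] by auto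
  then have cs: "independent_list cs"
    using e x inv by (auto simp: cs_def add.commute)
  have "m x (m x x) \<notin> U"
  proof
    assume *: "m x (m x x) \<in> U"
    obtain w where w: "w \<notin> U"
      using outside[of cs] by (auto simp: cs_def U_def)
    have "set (subset_sums (w # cs)) = UNIV"
      using w cs card by (intro subset_sums_eq_UNIV) (auto simp: U_def cs_def)
    then have cosets: "u \<in> U \<or> w + u \<in> U" for u
      by (auto simp: U_def shift_eq_map)
    \<comment> \<open>Multiplication by \<open>t\<close> is injective and hence permutes the finite
      set \<open>U\<close>, so it cannot send \<open>w\<close> into \<open>U\<close> as
      well.\<close>
    have stable: "m t w \<notin> U" if "t \<noteq> 0" "m t ` U \<subseteq> U" for t
    proof
      assume mem: "m t w \<in> U"
      have inj: "inj (m t)"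
        using that(1) no_zero_divisors
        by (intro injI) (metis add_eq_0_iff_eq add_right)
      then have "m t ` U = U"
        using that(2) by (intro endo_inj_surj) (auto simp: U_def intro: inj_on_subset)
      then show False
        using mem w inj by (metis imageE injD)
    qed
    have "set (map (m x) cs) \<subseteq> U"
      using * by (auto simp: cs_def unit U_def intro: in_subset_sums)
    then have "set (subset_sums (map (m x) cs)) \<subseteq> U"
      unfolding U_def by (rule subset_sums_subset)
    then have x_U: "m x ` U \<subseteq> U"
      by (simp add: subset_sums_map_right U_def)
    have "m (x + e) ` U \<subseteq> U"
      using x_U add_in_subset_sums[of _ cs] by (auto simp: add_left unit U_def)
    then have "m (x + e) w \<notin> U" "m x w \<notin> U"
      using stable x x_U by (auto simp: add_eq_0_iff_eq)
    \<comment> \<open>As \<open>U\<close> has index two, \<open>w + m (x + e) w\<close> lies in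
      \<open>U\<close>; but this element is \<open>m x w\<close>.\<close>
    then show False
      using cosets[of "m x w"] cosets[of "m (x + e) w"] by (simp add: add_left unit ac_simps)
  qed
  with cs show ?thesis
    using that[of x] by (simp add: U_def cs_def)
qed

section \<open>Linear forms and transport to coordinates\<close>

lemma additive_iff_linear_form: "linear_form (f :: bit ^ 'n \<Rightarrow> bit) \<longleftrightarrow> (\<forall>x y. f (x + y) = f x + f y)"
proof
  assume "linear_form f"
  then show "\<forall>x y. f (x + y) = f x + f y"
    by (simp add: linear_form_def Vector_Spaces.linear_iff)
next
  assume f: "\<forall>x y. f (x + y) = f x + f y"
  then have "f 0 = 0"
    by (metis add_0_right add_self_left add_self)
  then have "f (c *s x) = c * f x" for c x
    by (cases c) simp_all
  with f show "linear_form f"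
    by (simp add: linear_form_def Vector_Spaces.linear_iff vec.vector_space_axioms
        vector_space_over_itself.vector_space_axioms)
qed

lemma card_bit4: "CARD(bit ^ 4) = 16"
proof -
  have "(UNIV :: bit set) = {0, 1}"
    using bit_not_zero_iff by blast
  then have "CARD(bit) = 2"
    by (metis card_2_iff zero_neq_one)
  then show ?thesis
    by (simp add: CARD_vec)
qed

text \<open>The cyclic basis gives an additive bijection \<open>f\<close> from \<open>quad\<close>.
  Transported along it, the multiplication is normalised and thus equals some
  \<open>tensor_mult ts\<close> with nine triples; composing the forms with \<open>g\<close> and
  applying \<open>f\<close> to the vectors carries the decomposition back.\<close>

lemma sum_of_pure_tensors_9:
  fixes mult :: "bit ^ 4 \<Rightarrow> bit ^ 4 \<Rightarrow> bit ^ 4"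
  assumes "nonsingular mult" "\<And>y. mult e y = y" "\<And>y. mult y e = y"
  shows "sum_of_pure_tensors mult 9"
proof -
  interpret nonsingular mult by fact
  obtain x where x: "independent_list [mult x (mult x x), mult x x, x, e]"
    using exists_cyclic[OF assms(1) card_bit4 assms(2,3)] by blast
  define f where "f = (\<lambda>q. case q of Quad a b c d \<Rightarrow>
    a *s e + (b *s x + (c *s mult x x + d *s mult x (mult x x))))"
  have f_add: "f (p + q) = f p + f q" for p q
    by (cases p; cases q) (simp add: f_def vec.scale_left_distrib ac_simps)
  have f_0: "f 0 = 0"
    using f_add[of 0 0] by simp
  have f_unit: "map f unit_quads = [mult x (mult x x), mult x x, x, e]"
    by (simp add: unit_quads_def f_def)
  have sums: "map f (subset_sums unit_quads) = subset_sums [mult x (mult x x), mult x x, x, e]"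
    by (metis f_unit subset_sums_map f_add f_0)
  have "bij f"
  proof (rule bijI)
    have "distinct (map f (subset_sums unit_quads))"
      unfolding sums using x by (rule distinct_subset_sums)
    then show "inj f"
      by (simp add: distinct_map UNIV_quad)
    have "set (map f (subset_sums unit_quads)) = UNIV"
      unfolding sums using x card_bit4 by (intro subset_sums_eq_UNIV) simp_all
    then show "surj f"
      by (simp add: UNIV_quad)
  qed
  define g where "g = inv f"
  have gf [simp]: "g (f q) = q" and fg [simp]: "f (g v) = v" for q v
    using \<open>bij f\<close> by (simp_all add: g_def bij_is_inj bij_is_surj surj_f_inv_f)
  have g_add: "g (u + v) = g u + g v" for u v
    by (metis f_add gf fg)
  have g_eq_0: "g v = 0 \<longleftrightarrow> v = 0" for v
    by (metis f_0 gf fg)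
  define m where "m = (\<lambda>p q. g (mult (f p) (f q)))"
  have nonsing: "nonsingular m"
    by unfold_locales
      (use no_zero_divisors in \<open>auto simp: m_def f_add g_add add_left add_right g_eq_0, metis f_0 gf\<close>)
  have f_basis: "f (Quad 1 0 0 0) = e" "f (Quad 0 1 0 0) = x" "f (Quad 0 0 1 0) = mult x x"
    "f (Quad 0 0 0 1) = mult x (mult x x)"
    by (simp_all add: f_def)
  obtain ts where ts: "length ts = 9" "m = tensor_mult ts"
  proof (rule normalised_eq_tensor_mult[OF nonsing])
    show square: "m (Quad 0 1 0 0) (Quad 0 1 0 0) = Quad 0 0 1 0"
      by (metis m_def f_basis(2,3) gf)
    show "m (Quad 0 1 0 0) (m (Quad 0 1 0 0) (Quad 0 1 0 0)) = Quad 0 0 0 1"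
      unfolding square by (metis m_def f_basis(2-4) gf)
  qed (simp_all add: m_def f_basis assms(2,3))
  have tensor: "f (tensor_mult ts (g u) (g v)) = (\<Sum>i<length ts. (dot (fst (ts ! i)) (g u) *
      dot (fst (snd (ts ! i))) (g v)) *s f (snd (snd (ts ! i))))" for u v
  proof (induction ts)
    case (Cons t ts)
    have *: "f (if c = 1 then z else 0) = c *s f z" for c z
      by (cases c) (simp_all add: f_0)
    show ?case
      unfolding sum.lessThan_Suc_shift list.size(4) add_Suc_right
      using Cons by (simp add: f_add * split_beta del: sum.lessThan_Suc)
  qed (simp add: f_0)
  have "mult u v = f (m (g u) (g v))" for u v
    by (simp add: m_def)
  then have "mult u v = (\<Sum>i<9. (dot (fst (ts ! i)) (g u) *
      dot (fst (snd (ts ! i))) (g v)) *s f (snd (snd (ts ! i))))" for u v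
    by (simp add: ts tensor)
  then show ?thesis
    unfolding sum_of_pure_tensors_def additive_iff_linear_form
    by (intro exI[of _ "\<lambda>i u. dot (fst (ts ! i)) (g u)"]
      exI[of _ "\<lambda>i u. dot (fst (snd (ts ! i))) (g u)"] exI[of _ "\<lambda>i. f (snd (snd (ts ! i)))"])
      (simp add: dot_add g_add)
qed

section \<open>Binary codes of length eight, dimension four and distance four\<close>

text \<open>The Hamming weight of the word \<open>f 0 x, ..., f 7 x\<close>; the family
  \<open>f\<close> is the encoding map of a code of length 8.\<close>

definition weight :: "(nat \<Rightarrow> 'a \<Rightarrow> bit) \<Rightarrow> 'a \<Rightarrow> nat" where
  "weight f x = card {i. i < 8 \<and> f i x = 1}"

lemma weight_eq_sum: "int (weight f x) = (\<Sum>i<8. of_bool (f i x = 1))"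
proof -
  have "{..<8} \<inter> {i. f i x = 1} = {i. i < 8 \<and> f i x = 1}"
    by auto
  then show ?thesis
    by (simp add: weight_def)
qed

lemma sum_bits_eq_weight: "(\<Sum>i<8. f i x) = (of_nat (weight f x) :: bit)"
proof -
  have "(\<Sum>i<8. f i x) = (\<Sum>i<8. of_bool (f i x = 1))"
  proof (rule sum.cong)
    show "f i x = of_bool (f i x = 1)" for i
      by (cases "f i x") auto
  qed simp
  moreover have "{..<8} \<inter> {i. f i x = 1} = {i. i < 8 \<and> f i x = 1}"
    by auto
  ultimately show ?thesis
    by (simp add: weight_def)
qed

lemma even_iff_of_nat_bit: "even n \<longleftrightarrow> (of_nat n :: bit) = 0"
  by (induction n) auto

text \<open>Translation by \<open>x0\<close> exchanges the two values of \<open>f\<close>, so each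
  is taken on half of the group.\<close>

lemma sum_of_bool_additive:
  fixes f :: "'a::{char_two_group, finite} \<Rightarrow> bit"
  assumes f: "\<And>x y. f (x + y) = f x + f y" and "f x0 = 1"
  shows "2 * (\<Sum>x\<in>UNIV. of_bool (f x = 1) :: int) = CARD('a)"
proof -
  have "(\<Sum>x\<in>UNIV. of_bool (f x = 1) :: int) = (\<Sum>x\<in>UNIV. of_bool (f (x0 + x) = 1))"
    by (rule sum.reindex_bij_witness[of _ "(+) x0" "(+) x0"]) auto
  also have "\<dots> = (\<Sum>x\<in>UNIV. 1 - of_bool (f x = 1))"
  proof (rule sum.cong)
    show "of_bool (f (x0 + x) = 1) = (1 :: int) - of_bool (f x = 1)" for x
      by (cases "f x") (simp_all add: f \<open>f x0 = 1\<close>)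
  qed simp
  finally show ?thesis
    by (simp add: sum_subtractf)
qed

text \<open>All moments below run over the sixteen code words. The first moment is at most 64, which
  excludes odd weights and zero coordinates; then the second moment is at least 288,
  while \<open>w\<^sup>2 \<le> 10 w - 24\<close> for all the weights \<open>w\<close> of nonzero words would bound it by 280.\<close>

lemma code_8_4_4:
  fixes f :: "nat \<Rightarrow> 'a::{char_two_group, finite} \<Rightarrow> bit"
  assumes card: "CARD('a) = 16"
    and add: "\<And>i x y. f i (x + y) = f i x + f i y"
    and dist: "\<And>x. x \<noteq> 0 \<Longrightarrow> 4 \<le> weight f x"
  shows code_8_4_4_even: "(\<Sum>i<8. f i x) = 0"
    and code_8_4_4_all_one: "\<exists>x. \<forall>i<8. f i x = 1"
proof -
  define ind where "ind h = (\<Sum>x\<in>UNIV. of_bool (h x = 1) :: int)" for h :: "'a \<Rightarrow> bit"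
  have ind_cases: "ind h = 8 \<or> (ind h = 0 \<and> h = (\<lambda>_. 0))" if "\<And>x y. h (x + y) = h x + h y" for h
  proof (cases "\<exists>x0. h x0 = 1")
    case True
    then show ?thesis
      using sum_of_bool_additive[of h] that card by (auto simp: ind_def)
  next
    case False
    then have "h = (\<lambda>_. 0)"
      by auto
    then show ?thesis by (simp add: ind_def)
  qed
  have f0: "f i 0 = 0" for i
    using add[of i 0 0] by simp
  then have w0: "weight f 0 = 0"
    by (simp add: weight_def)
  have split0: "(\<Sum>x\<in>UNIV. g x) = g 0 + (\<Sum>x\<in>-{0}. g x)" for g :: "'a \<Rightarrow> int"
    by (simp add: sum.remove[of UNIV 0] Compl_eq_Diff_UNIV)
  have card0: "card (- {0 :: 'a}) = 15"
    using card by (simp add: Compl_eq_Diff_UNIV)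
  have first: "(\<Sum>x\<in>UNIV. int (weight f x)) = (\<Sum>i<8. ind (f i))"
    unfolding weight_eq_sum ind_def by (rule sum.swap)
  have ind_le: "ind (f i) \<le> 8" for i
    using ind_cases[of "f i"] add by auto
  have first_le: "(\<Sum>x\<in>UNIV. int (weight f x)) \<le> 64"
    using sum_bounded_above[of "{..<8::nat}" "\<lambda>i. ind (f i)" 8] ind_le first by simp
  define par where "par x = (\<Sum>i<8. f i x)" for x
  have par_even: "par x = 0 \<longleftrightarrow> even (weight f x)" for x
    by (simp add: par_def sum_bits_eq_weight even_iff_of_nat_bit)
  have "par = (\<lambda>_. 0)"
  proof (rule ccontr)
    assume "par \<noteq> (\<lambda>_. 0)"
    then have "ind par = 8"
      using ind_cases[of par] by (auto simp: par_def add sum.distrib)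
    moreover have "par 0 = 0"
      by (simp add: par_def f0)
    ultimately have "(\<Sum>x\<in>-{0}. of_bool (par x = 1) :: int) = 8"
      by (simp add: ind_def split0)
    \<comment> \<open>The eight elements of odd weight have weight at least 5, so the first moment
      would be at least 15 * 4 + 8 = 68.\<close>
    moreover have "(\<Sum>x\<in>-{0}. 4 + of_bool (par x = 1) :: int) \<le> (\<Sum>x\<in>-{0}. int (weight f x))"
    proof (rule sum_mono)
      fix x :: 'a assume "x \<in> -{0}"
      then have "4 \<le> weight f x"
        using dist by simp
      moreover have "weight f x \<noteq> 4" if "par x = 1"
        using par_even[of x] that by auto
      ultimately show "4 + of_bool (par x = 1) \<le> int (weight f x)"
        by (cases "par x = 1") auto
    qed
    ultimately show False
      using first_le card0 by (simp add: split0 w0 sum.distrib)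
  qed
  then show "(\<Sum>i<8. f i x) = 0"
    by (metis par_def)
  show "\<exists>x. \<forall>i<8. f i x = 1"
  proof (rule ccontr)
    assume none: "\<nexists>x. \<forall>i<8. f i x = 1"
    have weight_neq: "weight f x \<noteq> 8" for x
    proof
      assume "weight f x = 8"
      then have "{i. i < 8 \<and> f i x = 1} = {..<8}"
        by (intro card_seteq) (auto simp: weight_def)
      then show False
        using none by blast
    qed
    have weight_le: "weight f x \<le> 8" for x
      using card_mono[of "{..<8}" "{i. i < 8 \<and> f i x = 1}"] by (auto simp: weight_def)
    have weights: "weight f x = 4 \<or> weight f x = 6" if "x \<noteq> 0" for x
    proof -
      have "even (weight f x)"
        using \<open>par = (\<lambda>_. 0)\<close> par_even by simp
      moreover have "n = 4 \<or> n = 6" if "even n" "4 \<le> n" "n \<noteq> 8" "n \<le> 8" for n :: nat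
        using that by presburger
      ultimately show ?thesis
        using dist[OF that] weight_neq weight_le by blast
    qed
    have first_ge: "60 \<le> (\<Sum>i<8. ind (f i))"
      using sum_bounded_below[of "-{0}" 4 "\<lambda>x. int (weight f x)"] dist card0
      by (simp add: first[symmetric] split0 w0)
    \<comment> \<open>If a coordinate vanished identically, the others would contribute at most 7 *
      8 = 56, less than 60.\<close>
    have ind_8: "ind (f i) = 8" if "i < 8" for i
    proof (rule ccontr)
      assume "ind (f i) \<noteq> 8"
      then have "ind (f i) = 0"
        using ind_cases[of "f i"] add by auto
      then have "(\<Sum>j<8. ind (f j)) = (\<Sum>j\<in>{..<8} - {i}. ind (f j))"
        using that by (simp add: sum.remove[of _ i])
      also have "\<dots> \<le> of_nat (card ({..<8} - {i})) * 8"
        by (rule sum_bounded_above) (rule ind_le)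
      finally show False
        using first_ge that by simp
    qed
    \<comment> \<open>Inclusion-exclusion for two coordinates: each is 1 on eight elements and their
      sum on at most eight, so at least four elements have both equal to 1.\<close>
    have pair: "(\<Sum>x\<in>UNIV. of_bool (f i x = 1) * of_bool (f j x = 1)) \<ge> (if i = j then 8 else 4 :: int)"
      if "i < 8" "j < 8" for i j
    proof (cases "i = j")
      case True
      then show ?thesis
        using ind_8[OF that(1)] by (simp add: ind_def)
    next
      case False
      have "ind (\<lambda>x. f i x + f j x) \<le> 8"
        using ind_cases[of "\<lambda>x. f i x + f j x"] by (auto simp: add ac_simps)
      moreover have "ind (\<lambda>x. f i x + f j x) + 2 * (\<Sum>x\<in>UNIV. of_bool (f i x = 1) * of_bool (f j x = 1))
          = ind (f i) + ind (f j)"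
      proof -
        have "of_bool (b + c = 1) + 2 * (of_bool (b = 1) * of_bool (c = 1)) =
            of_bool (b = 1) + (of_bool (c = 1) :: int)" for b c :: bit
          by (cases b; cases c) simp_all
        then show ?thesis
          unfolding ind_def sum_distrib_left sum.distrib[symmetric] by (intro sum.cong) auto
      qed
      ultimately show ?thesis
        using ind_8 that False by simp
    qed
    \<comment> \<open>The eight diagonal pairs count 8 each and the 56 others count 4 each.\<close>
    have "288 = (\<Sum>i<8::nat. \<Sum>j<8::nat. if i = j then 8 else 4 :: int)"
      by (simp add: lessThan_nat_numeral lessThan_Suc)
    also have "\<dots> \<le> (\<Sum>i<8. \<Sum>j<8. \<Sum>x\<in>UNIV. of_bool (f i x = 1) * of_bool (f j x = 1))"
      using pair by (intro sum_mono) auto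
    also have "\<dots> = (\<Sum>i<8. \<Sum>x\<in>UNIV. \<Sum>j<8. of_bool (f i x = 1) * of_bool (f j x = 1))"
      by (intro sum.cong refl sum.swap)
    also have "\<dots> = (\<Sum>x\<in>UNIV. \<Sum>i<8. \<Sum>j<8. of_bool (f i x = 1) * of_bool (f j x = 1))"
      by (rule sum.swap)
    also have "\<dots> = (\<Sum>x\<in>UNIV. (int (weight f x))\<^sup>2)"
      unfolding weight_eq_sum power2_eq_square sum_product ..
    also have "\<dots> = (\<Sum>x\<in>-{0}. (int (weight f x))\<^sup>2)"
      by (simp add: split0 w0)
    \<comment> \<open>The remaining weights 4 and 6 are the roots of
      \<open>(w - 4) * (w - 6)\<close>.\<close>
    also have "\<dots> = (\<Sum>x\<in>-{0}. 10 * int (weight f x) - 24)"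
    proof (rule sum.cong)
      fix x :: 'a assume "x \<in> -{0}"
      then show "(int (weight f x))\<^sup>2 = 10 * int (weight f x) - 24"
        using weights[of x] by auto
    qed simp
    also have "\<dots> = 10 * (\<Sum>x\<in>UNIV. int (weight f x)) - 360"
      by (simp add: sum_subtractf split0 w0 card0 sum_distrib_left)
    finally show False
      using first_le by simp
  qed
qed

section \<open>Lower bound\<close>

text \<open>The coordinates \<open>g i\<close> with \<open>i\<close> in the support of the word of
  \<open>x\<close> already separate the sixteen elements \<open>y\<close>, so a support of size
  \<open>s\<close> satisfies \<open>16 \<le> 2 ^ s\<close>.\<close>

lemma weight_ge_4:
  fixes g :: "nat \<Rightarrow> 'b::{char_two_group, finite} \<Rightarrow> bit"
  assumes card: "CARD('b) = 16" and add: "\<And>i x y. g i (x + y) = g i x + g i y"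
    and separating: "\<And>y. (\<And>i. i < 8 \<Longrightarrow> f i x = 1 \<Longrightarrow> g i y = 0) \<Longrightarrow> y = 0"
  shows "4 \<le> weight f x"
proof -
  define S where "S = {i. i < 8 \<and> f i x = 1}"
  define h where "h y = {i \<in> S. g i y = 1}" for y
  have "inj h"
  proof (rule injI)
    fix y y' assume "h y = h y'"
    have "g i (y + y') = 0" if "i < 8" "f i x = 1" for i
    proof -
      have "g i y = 1 \<longleftrightarrow> g i y' = 1"
        using \<open>h y = h y'\<close> that by (auto simp: h_def S_def set_eq_iff)
      then show ?thesis
        by (cases "g i y"; cases "g i y'") (simp_all add: add)
    qed
    then show "y = y'"
      using separating[of "y + y'"] by (simp add: add_eq_0_iff_eq)
  qed
  moreover have "finite S"
    by (simp add: S_def)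
  ultimately have "CARD('b) \<le> card (Pow S)"
    by (intro card_inj_on_le[of h]) (auto simp: h_def)
  then have "(2::nat) ^ 4 \<le> 2 ^ card S"
    using card \<open>finite S\<close> by (simp add: card_Pow)
  then have "4 \<le> card S"
    by (simp only: power_increasing_iff)
  then show ?thesis
    by (simp add: weight_def S_def)
qed

lemma not_sum_of_pure_tensors:
  fixes mult :: "bit ^ 4 \<Rightarrow> bit ^ 4 \<Rightarrow> bit ^ 4"
  assumes "nonsingular mult" "R \<le> 8"
  shows "\<not> sum_of_pure_tensors mult R"
proof
  assume "sum_of_pure_tensors mult R"
  then obtain a' b' z where forms: "\<And>i. i < R \<Longrightarrow> linear_form (a' i) \<and> linear_form (b' i)"
    and mult': "\<And>x y. mult x y = (\<Sum>i<R. (a' i x * b' i y) *s z i)"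
    by (auto simp: sum_of_pure_tensors_def)
  interpret nonsingular mult by fact
  \<comment> \<open>Zero forms pad the decomposition to exactly eight terms; the vectors
    \<open>z i\<close> with \<open>i \<ge> R\<close> are arbitrary, but have coefficient 0.\<close>
  define a where "a i x = (if i < R then a' i x else 0)" for i x
  define b where "b i x = (if i < R then b' i x else 0)" for i x
  have a_add: "a i (x + y) = a i x + a i y" and b_add: "b i (x + y) = b i x + b i y" for i x y
    using forms by (auto simp: a_def b_def additive_iff_linear_form)
  have mult: "mult x y = (\<Sum>i<8. (a i x * b i y) *s z i)" for x y
    unfolding mult' using \<open>R \<le> 8\<close>
    by (intro sum.mono_neutral_cong_left) (auto simp: a_def b_def)
  have mult_eq_0: "mult x y = 0" if "\<And>i. i < 8 \<Longrightarrow> a i x = 1 \<Longrightarrow> b i y = 0" for x y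
    unfolding mult
  proof (rule sum.neutral, rule ballI)
    fix i :: nat assume "i \<in> {..<8}"
    then show "(a i x * b i y) *s z i = 0"
      using that[of i] by (cases "a i x") auto
  qed
  \<comment> \<open>The code of \<open>z\<close>: \<open>c i w\<close> is the value at
    \<open>z i\<close> of the functional with coefficient vector \<open>w\<close>.\<close>
  define c where "c i w = (\<Sum>k\<in>UNIV. w $ k * z i $ k)" for i and w :: "bit ^ 4"
  have c_add: "c i (v + w) = c i v + c i w" for i v w
    by (simp add: c_def distrib_right sum.distrib)
  have functional: "(\<Sum>k\<in>UNIV. w $ k * mult x y $ k) = (\<Sum>i<8. c i w * (a i x * b i y))" for w x y
  proof -
    have "(\<Sum>k\<in>UNIV. w $ k * mult x y $ k) = (\<Sum>k\<in>UNIV. \<Sum>i<8. w $ k * z i $ k * (a i x * b i y))"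
      by (simp add: mult sum_distrib_left ac_simps)
    also have "\<dots> = (\<Sum>i<8. \<Sum>k\<in>UNIV. w $ k * z i $ k * (a i x * b i y))"
      by (rule sum.swap)
    finally show ?thesis
      by (simp add: c_def sum_distrib_right)
  qed
  have "4 \<le> weight a x" if "x \<noteq> 0" for x
  proof (rule weight_ge_4[OF card_bit4, of b])
    fix y assume "\<And>i. i < 8 \<Longrightarrow> a i x = 1 \<Longrightarrow> b i y = 0"
    then show "y = 0"
      using mult_eq_0 no_zero_divisors that by blast
  qed (rule b_add)
  then obtain x where x: "\<forall>i<8. a i x = 1"
    using code_8_4_4_all_one[of a] card_bit4 a_add by blast
  have "4 \<le> weight b y" if "y \<noteq> 0" for y
  proof (rule weight_ge_4[OF card_bit4, of a])
    fix x assume "\<And>i. i < 8 \<Longrightarrow> b i y = 1 \<Longrightarrow> a i x = 0"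
    then have "mult x y = 0"
      by (intro mult_eq_0) (metis bit_not_one_iff zero_neq_one)
    then show "x = 0"
      using no_zero_divisors that by blast
  qed (rule a_add)
  then obtain y where y: "\<forall>i<8. b i y = 1"
    using code_8_4_4_all_one[of b] card_bit4 b_add by blast
  have "4 \<le> weight c w" if "w \<noteq> 0" for w
  proof (rule weight_ge_4[OF card_bit4, of a])
    fix x assume x: "\<And>i. i < 8 \<Longrightarrow> c i w = 1 \<Longrightarrow> a i x = 0"
    have "c i w * (a i x * b i y) = 0" if "i < 8" for i y
      using x[OF that] by (cases "c i w") auto
    then have orth: "(\<Sum>k\<in>UNIV. w $ k * mult x y $ k) = 0" for y
      unfolding functional by (intro sum.neutral) auto
    \<comment> \<open>For \<open>x \<noteq> 0\<close> the products \<open>mult x y\<close> fill the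
      whole space, so a functional vanishing on all of them is zero, contrary to
      \<open>w \<noteq> 0\<close>.\<close>
    show "x = 0"
    proof (rule ccontr)
      assume "x \<noteq> 0"
      then have "inj (mult x)"
        using no_zero_divisors by (intro injI) (metis add_eq_0_iff_eq add_right)
      then have surj: "surj (mult x)"
        by (simp add: finite_UNIV_inj_surj)
      have "w $ k = 0" for k
      proof -
        obtain y where "mult x y = axis k 1"
          using surj by (metis surjD)
        then show ?thesis
          using orth[of y] by (simp add: axis_def if_distrib cong: if_cong)
      qed
      with that show False
        by (simp add: vec_eq_iff)
    qed
  qed (rule a_add)
  then have even: "(\<Sum>i<8. c i w) = 0" for w
    using code_8_4_4_even[of c] card_bit4 c_add by blast
  \<comment> \<open>All coefficients are 1 for these \<open>x\<close> and \<open>y\<close>, so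
    coordinate \<open>k\<close> of the product is the parity of the word of the \<open>k\<close>-th
    coordinate functional.\<close>
  have "mult x y $ k = 0" for k
    using functional[of "axis k 1" x y] even[of "axis k 1"] x y
    by (simp add: axis_def if_distrib[of "\<lambda>u. u * _"] cong: if_cong)
  then have "mult x y = 0"
    by (simp add: vec_eq_iff)
  then have "x = 0 \<or> y = 0"
    by (rule no_zero_divisors)
  \<comment> \<open>The all-one words cannot come from zero, since additive maps vanish there; one
    coordinate suffices to see this.\<close>
  moreover have "a 0 0 = 0" "b 0 0 = 0"
    using a_add[of 0 0 0] b_add[of 0 0 0] by simp_all
  ultimately show False
    using x y by (metis zero_less_numeral zero_neq_one)
qed

theorem theorem3:
  fixes mult :: "bit ^ 4 \<Rightarrow> bit ^ 4 \<Rightarrow> bit ^ 4"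
  assumes "finite_semifield mult"
  shows "tensor_rank mult = 9"
proof -
  have "\<forall>x y y'. mult x (y + y') = mult x y + mult x y'"
    "\<forall>x x' y. mult (x + x') y = mult x y + mult x' y"
    using assms by (auto simp: finite_semifield_def bilinear_mult_def Vector_Spaces.linear_iff)
  then have nonsing: "nonsingular mult"
    using assms by unfold_locales (auto simp: finite_semifield_def)
  obtain e where "\<forall>x. mult e x = x \<and> mult x e = x"
    using assms by (auto simp: finite_semifield_def)
  then have "sum_of_pure_tensors mult 9"
    using sum_of_pure_tensors_9 nonsing by blast
  moreover have "9 \<le> R" if "sum_of_pure_tensors mult R" for R
    using not_sum_of_pure_tensors[OF nonsing, of R] that by (cases "R \<le> 8") auto
  ultimately show ?thesis
    unfolding tensor_rank_def by (rule Least_equality)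
qed

end
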